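(* Let $p$ be a prime, $1<r<\infty$ and $\alpha>0$. Let $\mathcal{K}:\mathbb{R}_+\times\mathbb{R}_+\to[0,\infty)$ be homogeneous of degree $-1$, i.e. $\mathcal{K}(\xi s,\xi t)=\xi^{-1}\mathcal{K}(s,t)$ for all $\xi,s,t>0$, and let $$\mathscr{T}^pf(x)=\int_{\mathbb{Q}_p^*}\mathcal{K}(|x|_p,|y|_p)f(y)\,dy,\qquad x\in\mathbb{Q}_p^*.$$ If $$C_{r,\alpha}=2(1-p^{-1})\sum_{k=-\infty}^{\infty}\mathcal{K}(1,p^k)\,p^{-k(1/r+\alpha-1)}<\infty,$$ then for all $f\in\mathfrak{B}_{r,\alpha}(\mathbb{Q}_p^* )$, $$\|\mathscr{T}^pf\|_{\mathfrak{B}_{r,\alpha}(\mathbb{Q}_p^* )}\le C_{r,\alpha}\,\|f\|_{\mathfrak{B}_{r,\alpha}(\mathbb{Q}_p^* )}.$$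
   Context: $\mathbb{Q}_p$ is the field of $p$-adic numbers with absolute value $|\cdot|_p$, $\mathbb{Q}_p^*=\mathbb{Q}_p\setminus\{0\}$, and $\mathbb{R}_+=(0,\infty)$. $dx$ is the Haar measure on the additive group $\mathbb{Q}_p$ normalized so that $\{|x|_p\le1\}$ has measure $1$, and $|E|$ denotes the Haar measure of $E$. For $n\in\mathbb{Z}$, $B^n=\{x\in\mathbb{Q}_p:|x|_p\le p^n\}$, so $|B^n|=p^n$. A function $a:\mathbb{Q}_p^*\to\mathbb{C}$ is a central $(r,\alpha)$-block if there exists $n\in\mathbb{Z}$ such that $\operatorname{supp}a\subset B^n$ and $\|a\|_{L^r}\le|B^n|^{-\alpha}$. The block space $\mathfrak{B}_{r,\alpha}(\mathbb{Q}_p^* )$ is the set of all $f\in L^r_{\mathrm{loc}}(\mathbb{Q}_p^* )$ that can be written as $f=\sum_{k=1}^\infty\lambda_ka_k$ (almost everywhere) with scalars $\lambda_k$ satisfying $\sum_k|\lambda_k|<\infty$ and each $a_k$ a central $(r,\alpha)$-block; its norm is $\|f\|_{\mathfrak{B}_{r,\alpha}(\mathbb{Q}_p^* )}=\inf\sum_{k=1}^\infty|\lambda_k|$, the infimum being over all such decompositions of $f$. *)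

theory Defs
  imports "HOL-Analysis.Analysis" "HOL-Computational_Algebra.Primes" "HOL-Algebra.QuotRing"
begin

section \<open>The field of p-adic numbers\<close>

definition rat_pabs :: "nat \<Rightarrow> rat \<Rightarrow> real" where
  "rat_pabs p q =
     (if q = 0 then 0
      else real p powi (int (multiplicity (int p) (snd (quotient_of q))) -
                        int (multiplicity (int p) (fst (quotient_of q)))))"

definition rat_pCauchy :: "nat \<Rightarrow> (nat \<Rightarrow> rat) ring" where
  "rat_pCauchy p =
     \<lparr>carrier = {X. \<forall>e>0. \<exists>N. \<forall>m\<ge>N. \<forall>n\<ge>N. rat_pabs p (X m - X n) < e},
      mult = (\<lambda>X Y n. X n * Y n), one = (\<lambda>n. 1),
      zero = (\<lambda>n. 0), add = (\<lambda>X Y n. X n + Y n)\<rparr>"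

definition rat_pnull :: "nat \<Rightarrow> (nat \<Rightarrow> rat) set" where
  "rat_pnull p = {X. (\<lambda>n. rat_pabs p (X n)) \<longlonglongrightarrow> 0}"

text \<open>The completion of the rationals: Cauchy sequences modulo null sequences.\<close>

definition Qp :: "nat \<Rightarrow> (nat \<Rightarrow> rat) set ring" where
  "Qp p = rat_pCauchy p Quot rat_pnull p"

abbreviation Qp_star :: "nat \<Rightarrow> (nat \<Rightarrow> rat) set set" where
  "Qp_star p \<equiv> carrier (Qp p) - {\<zero>\<^bsub>Qp p\<^esub>}"

text \<open>An element of \<^term>\<open>Qp p\<close> is a class of Cauchy sequences; its absolute value is the limit
  of the absolute values along any representing sequence.\<close>

definition pabs :: "nat \<Rightarrow> (nat \<Rightarrow> rat) set \<Rightarrow> real" where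
  "pabs p x = (THE c. \<forall>X\<in>x. (\<lambda>n. rat_pabs p (X n)) \<longlonglongrightarrow> c)"

text \<open>The value off the carrier is a dummy, since \<^locale>\<open>Metric_space\<close> wants
  a distance that is nonnegative and symmetric on the whole type.\<close>

definition pdist :: "nat \<Rightarrow> (nat \<Rightarrow> rat) set \<Rightarrow> (nat \<Rightarrow> rat) set \<Rightarrow> real" where
  "pdist p x y = (if x \<in> carrier (Qp p) \<and> y \<in> carrier (Qp p)
                  then pabs p (x \<ominus>\<^bsub>Qp p\<^esub> y) else 0)"

definition ptop :: "nat \<Rightarrow> (nat \<Rightarrow> rat) set topology" where
  "ptop p = Metric_space.mtopology (carrier (Qp p)) (pdist p)"

definition pball :: "nat \<Rightarrow> int \<Rightarrow> (nat \<Rightarrow> rat) set set" where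
  "pball p n = {x \<in> carrier (Qp p). pabs p x \<le> real p powi n}"


subsection \<open>The construction yields a field with a non-archimedean absolute value\<close>

lemma rat_pabs_0 [simp]: "rat_pabs p 0 = 0"
  by (simp add: rat_pabs_def)

lemma rat_pabs_fract:
  assumes p: "prime p" and ab: "a \<noteq> 0" "b \<noteq> 0"
  shows "rat_pabs p (of_int a / of_int b) =
           real p powi (int (multiplicity (int p) b) - int (multiplicity (int p) a))"
proof -
  obtain n d where nd: "quotient_of (of_int a / of_int b) = (n, d)" by fastforce
  have d0: "d \<noteq> 0" using quotient_of_denom_pos[OF nd] by simp
  have eq: "(of_int a / of_int b :: rat) = of_int n / of_int d"
    by (rule quotient_of_div[OF nd])
  have n0: "n \<noteq> 0" using eq ab d0 by auto
  have "(of_int (a * d) :: rat) = of_int (n * b)" using eq ab d0 by (simp add: field_simps)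
  hence "a * d = n * b" by (simp only: of_int_eq_iff)
  moreover have "prime_elem (int p)" using p by simp
  ultimately have "multiplicity (int p) a + multiplicity (int p) d =
      multiplicity (int p) n + multiplicity (int p) b"
    using ab d0 n0 by (metis prime_elem_multiplicity_mult_distrib)
  hence "int (multiplicity (int p) d) - int (multiplicity (int p) n) =
         int (multiplicity (int p) b) - int (multiplicity (int p) a)" by linarith
  thus ?thesis using ab nd by (simp add: rat_pabs_def)
qed

lemma rat_eq_fract: obtains a b :: int where "(q :: rat) = of_int a / of_int b" "b \<noteq> 0"
proof -
  obtain n d where nd: "quotient_of q = (n, d)" by fastforce
  show ?thesis using quotient_of_div[OF nd] quotient_of_denom_pos[OF nd] by (intro that[of n d]) auto
qed

lemma rat_pabs_nonneg: "rat_pabs p q \<ge> 0"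
  by (simp add: rat_pabs_def)

lemma rat_pabs_eq_0_iff: "prime p \<Longrightarrow> rat_pabs p q = 0 \<longleftrightarrow> q = 0"
  by (auto simp: rat_pabs_def power_int_eq_0_iff dest: prime_gt_0_nat)

lemma rat_pabs_1: "rat_pabs p 1 = 1"
  by (simp add: rat_pabs_def)

lemma rat_pabs_mult:
  assumes p: "prime p" shows "rat_pabs p (q * r) = rat_pabs p q * rat_pabs p r"
proof (cases "q = 0 \<or> r = 0")
  case False
  obtain a b where q: "q = of_int a / of_int b" "b \<noteq> 0" by (rule rat_eq_fract)
  obtain c d where r: "r = of_int c / of_int d" "d \<noteq> 0" by (rule rat_eq_fract)
  have ac: "a \<noteq> 0" "c \<noteq> 0" using False q r by auto
  have "q * r = of_int (a * c) / of_int (b * d)" using q r by simp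
  hence "rat_pabs p (q * r) = real p powi (int (multiplicity (int p) (b * d)) -
      int (multiplicity (int p) (a * c)))"
    using rat_pabs_fract[OF p, of "a * c" "b * d"] ac q r by simp
  also have "\<dots> = real p powi ((int (multiplicity (int p) b) - int (multiplicity (int p) a)) +
      (int (multiplicity (int p) d) - int (multiplicity (int p) c)))"
    using p ac q r by (simp add: prime_elem_multiplicity_mult_distrib algebra_simps)
  also have "\<dots> = rat_pabs p q * rat_pabs p r"
    using p ac q r prime_gt_0_nat[OF p]
    by (subst power_int_add) (auto simp: rat_pabs_fract)
  finally show ?thesis .
qed auto

lemma rat_pabs_minus: "prime p \<Longrightarrow> rat_pabs p (- q) = rat_pabs p q"
proof -
  assume p: "prime p"
  have "rat_pabs p (-1) = 1"
    using rat_pabs_fract[OF p, of "-1" 1] by (simp add: multiplicity_unit_right)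
  thus ?thesis using rat_pabs_mult[OF p, of "-1" q] by simp
qed

lemma rat_pabs_diff_commute: "prime p \<Longrightarrow> rat_pabs p (q - r) = rat_pabs p (r - q)"
  using rat_pabs_minus[of p "q - r"] by simp

lemma rat_pabs_inverse:
  assumes p: "prime p" shows "rat_pabs p (inverse q) = inverse (rat_pabs p q)"
proof (cases "q = 0")
  case False
  hence "rat_pabs p q * rat_pabs p (inverse q) = 1"
    using rat_pabs_mult[OF p, of q "inverse q"] by (simp add: rat_pabs_1)
  thus ?thesis by (metis inverse_unique)
qed simp

lemma rat_pabs_add_le_max:
  assumes p: "prime p" shows "rat_pabs p (q + r) \<le> max (rat_pabs p q) (rat_pabs p r)"
proof (cases "q = 0 \<or> r = 0 \<or> q + r = 0")
  case True thus ?thesis using rat_pabs_nonneg[of p] by (auto simp: le_max_iff_disj)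
next
  case False
  obtain a b where q: "q = of_int a / of_int b" "b \<noteq> 0" by (rule rat_eq_fract)
  obtain c d where r: "r = of_int c / of_int d" "d \<noteq> 0" by (rule rat_eq_fract)
  define A C D where "A = a * d" and "C = c * b" and "D = b * d"
  have q': "q = of_int A / of_int D" and r': "r = of_int C / of_int D" and D: "D \<noteq> 0"
    using q r by (auto simp: A_def C_def D_def)
  have s': "q + r = of_int (A + C) / of_int D" using q' r' by (simp add: add_divide_distrib)
  have nz: "A \<noteq> 0" "C \<noteq> 0" "A + C \<noteq> 0" using False q' r' s' by auto
  let ?m = "\<lambda>x. multiplicity (int p) x"
  have "int p ^ min (?m A) (?m C) dvd A + C"
    by (intro dvd_add multiplicity_dvd') auto
  moreover have "\<not> is_unit (int p)" using p prime_gt_1_nat by auto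
  ultimately have m: "min (?m A) (?m C) \<le> ?m (A + C)"
    using nz by (intro multiplicity_geI) auto
  have p1: "1 \<le> real p" using prime_gt_1_nat[OF p] by simp
  have "rat_pabs p (q + r) \<le> real p powi (int (?m D) - int (min (?m A) (?m C)))"
    unfolding s' using rat_pabs_fract[OF p nz(3) D] m p1 by (auto intro!: power_int_increasing)
  also have "\<dots> \<le> max (rat_pabs p q) (rat_pabs p r)"
    unfolding q' r' rat_pabs_fract[OF p nz(1) D] rat_pabs_fract[OF p nz(2) D]
    by (cases "?m A \<le> ?m C") (auto simp: min_def)
  finally show ?thesis .
qed

lemma rat_pabs_triangle:
  assumes p: "prime p" shows "rat_pabs p (q + r) \<le> rat_pabs p q + rat_pabs p r"
proof -
  have "rat_pabs p (q + r) \<le> max (rat_pabs p q) (rat_pabs p r)"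
    by (rule rat_pabs_add_le_max[OF p])
  also have "\<dots> \<le> rat_pabs p q + rat_pabs p r"
    using rat_pabs_nonneg[of p q] rat_pabs_nonneg[of p r] by simp
  finally show ?thesis .
qed

lemma rat_pabs_abs_diff:
  assumes p: "prime p" shows "\<bar>rat_pabs p q - rat_pabs p r\<bar> \<le> rat_pabs p (q - r)"
proof -
  have "rat_pabs p q \<le> rat_pabs p (q - r) + rat_pabs p r"
    using rat_pabs_triangle[OF p, of "q - r" r] by simp
  moreover have "rat_pabs p r \<le> rat_pabs p (q - r) + rat_pabs p q"
    using rat_pabs_triangle[OF p, of "r - q" q]
    unfolding rat_pabs_diff_commute[OF p, of q r] by simp
  ultimately show ?thesis by linarith
qed

lemma rat_pCauchy_simps [simp]:
  "X \<oplus>\<^bsub>rat_pCauchy p\<^esub> Y = (\<lambda>n. X n + Y n)" "X \<otimes>\<^bsub>rat_pCauchy p\<^esub> Y = (\<lambda>n. X n * Y n)"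
  "\<zero>\<^bsub>rat_pCauchy p\<^esub> = (\<lambda>n. 0)" "\<one>\<^bsub>rat_pCauchy p\<^esub> = (\<lambda>n. 1)"
  by (simp_all add: rat_pCauchy_def)

lemma rat_pCauchyI:
  "(\<And>e. e > 0 \<Longrightarrow> \<exists>N. \<forall>m\<ge>N. \<forall>n\<ge>N. rat_pabs p (X m - X n) < e) \<Longrightarrow> X \<in> carrier (rat_pCauchy p)"
  by (simp add: rat_pCauchy_def)

lemma rat_pCauchyD:
  "X \<in> carrier (rat_pCauchy p) \<Longrightarrow> e > 0 \<Longrightarrow> \<exists>N. \<forall>m\<ge>N. \<forall>n\<ge>N. rat_pabs p (X m - X n) < e"
  by (simp add: rat_pCauchy_def)

lemma rat_pCauchy_convergent:
  assumes p: "prime p" and X: "X \<in> carrier (rat_pCauchy p)"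
  shows "convergent (\<lambda>n. rat_pabs p (X n))"
proof -
  have "Cauchy (\<lambda>n. rat_pabs p (X n))"
    unfolding Cauchy_def dist_real_def
  proof (intro allI impI)
    fix e :: real assume "e > 0"
    then obtain N where "\<forall>m\<ge>N. \<forall>n\<ge>N. rat_pabs p (X m - X n) < e"
      using rat_pCauchyD[OF X] by blast
    thus "\<exists>N. \<forall>m\<ge>N. \<forall>n\<ge>N. \<bar>rat_pabs p (X m) - rat_pabs p (X n)\<bar> < e"
      by (intro exI[of _ N]) (auto intro: le_less_trans[OF rat_pabs_abs_diff[OF p]])
  qed
  thus ?thesis by (simp add: Cauchy_convergent_iff)
qed

lemma rat_pCauchy_bounded:
  assumes p: "prime p" and X: "X \<in> carrier (rat_pCauchy p)"
  obtains B where "B > 0" "\<And>n. rat_pabs p (X n) \<le> B"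
  using convergent_imp_Bseq[OF rat_pCauchy_convergent[OF p X]] rat_pabs_nonneg[of p]
  by (auto simp: Bseq_def)

lemma rat_pCauchy_add:
  assumes p: "prime p" and X: "X \<in> carrier (rat_pCauchy p)" and Y: "Y \<in> carrier (rat_pCauchy p)"
  shows "(\<lambda>n. X n + Y n) \<in> carrier (rat_pCauchy p)"
proof (rule rat_pCauchyI)
  fix e :: real assume e: "e > 0"
  obtain M where M: "\<And>m n. m \<ge> M \<Longrightarrow> n \<ge> M \<Longrightarrow> rat_pabs p (X m - X n) < e"
    using rat_pCauchyD[OF X e] by blast
  obtain N where N: "\<And>m n. m \<ge> N \<Longrightarrow> n \<ge> N \<Longrightarrow> rat_pabs p (Y m - Y n) < e"
    using rat_pCauchyD[OF Y e] by blast
  have "rat_pabs p (X m + Y m - (X n + Y n)) < e" if "m \<ge> max M N" "n \<ge> max M N" for m n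
    using rat_pabs_add_le_max[OF p, of "X m - X n" "Y m - Y n"] M[of m n] N[of m n] that
    by (simp add: algebra_simps)
  thus "\<exists>N. \<forall>m\<ge>N. \<forall>n\<ge>N. rat_pabs p (X m + Y m - (X n + Y n)) < e" by blast
qed

lemma rat_pCauchy_mult:
  assumes p: "prime p" and X: "X \<in> carrier (rat_pCauchy p)" and Y: "Y \<in> carrier (rat_pCauchy p)"
  shows "(\<lambda>n. X n * Y n) \<in> carrier (rat_pCauchy p)"
proof (rule rat_pCauchyI)
  fix e :: real assume e: "e > 0"
  obtain A where A: "A > 0" "\<And>n. rat_pabs p (X n) \<le> A" using rat_pCauchy_bounded[OF p X] by blast
  obtain B where B: "B > 0" "\<And>n. rat_pabs p (Y n) \<le> B" using rat_pCauchy_bounded[OF p Y] by blast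
  obtain M where M: "\<And>m n. m \<ge> M \<Longrightarrow> n \<ge> M \<Longrightarrow> rat_pabs p (X m - X n) < e / B"
    using rat_pCauchyD[OF X, of "e / B"] e B by auto
  obtain N where N: "\<And>m n. m \<ge> N \<Longrightarrow> n \<ge> N \<Longrightarrow> rat_pabs p (Y m - Y n) < e / A"
    using rat_pCauchyD[OF Y, of "e / A"] e A by auto
  have "rat_pabs p (X m * Y m - X n * Y n) < e" if mn: "m \<ge> max M N" "n \<ge> max M N" for m n
  proof -
    have "rat_pabs p (X m - X n) * rat_pabs p (Y m) \<le> rat_pabs p (X m - X n) * B"
      by (intro mult_left_mono B rat_pabs_nonneg)
    moreover have "rat_pabs p (X m - X n) * B < e"
      using M[of m n] mn B by (simp add: pos_less_divide_eq)
    ultimately have 1: "rat_pabs p (X m - X n) * rat_pabs p (Y m) < e" by linarith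
    have "rat_pabs p (X n) * rat_pabs p (Y m - Y n) \<le> A * rat_pabs p (Y m - Y n)"
      by (intro mult_right_mono A rat_pabs_nonneg)
    moreover have "A * rat_pabs p (Y m - Y n) < e"
      using N[of m n] mn A by (simp add: pos_less_divide_eq mult.commute)
    ultimately have 2: "rat_pabs p (X n) * rat_pabs p (Y m - Y n) < e" by linarith
    have "X m * Y m - X n * Y n = (X m - X n) * Y m + X n * (Y m - Y n)"
      by (simp add: algebra_simps)
    thus ?thesis
      using rat_pabs_add_le_max[OF p, of "(X m - X n) * Y m" "X n * (Y m - Y n)"] 1 2
      by (simp add: rat_pabs_mult[OF p])
  qed
  thus "\<exists>N. \<forall>m\<ge>N. \<forall>n\<ge>N. rat_pabs p (X m * Y m - X n * Y n) < e" by blast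
qed

lemma rat_pCauchy_const: "(\<lambda>n. c) \<in> carrier (rat_pCauchy p)"
  by (rule rat_pCauchyI) auto

lemma rat_pCauchy_minus:
  assumes p: "prime p" and X: "X \<in> carrier (rat_pCauchy p)"
  shows "(\<lambda>n. - X n) \<in> carrier (rat_pCauchy p)"
  using rat_pCauchy_mult[OF p rat_pCauchy_const[of "-1"] X] by simp

lemma cring_rat_pCauchy:
  assumes p: "prime p" shows "cring (rat_pCauchy p)"
proof (rule cringI)
  show "abelian_group (rat_pCauchy p)"
  proof (rule abelian_groupI)
    fix X assume X: "X \<in> carrier (rat_pCauchy p)"
    show "\<exists>Y\<in>carrier (rat_pCauchy p). Y \<oplus>\<^bsub>rat_pCauchy p\<^esub> X = \<zero>\<^bsub>rat_pCauchy p\<^esub>"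
      by (rule bexI[OF _ rat_pCauchy_minus[OF p X]]) simp
  qed (auto simp: rat_pCauchy_add[OF p] rat_pCauchy_const ac_simps)
  show "Group.comm_monoid (rat_pCauchy p)"
    by (rule comm_monoidI) (auto simp: rat_pCauchy_mult[OF p] rat_pCauchy_const ac_simps)
qed (auto simp: algebra_simps)

lemma rat_pnull_iff: "X \<in> rat_pnull p \<longleftrightarrow> (\<forall>e>0. \<exists>N. \<forall>n\<ge>N. rat_pabs p (X n) < e)"
  using rat_pabs_nonneg[of p] by (simp add: rat_pnull_def LIMSEQ_iff)

lemma rat_pnull_subset:
  assumes p: "prime p" shows "rat_pnull p \<subseteq> carrier (rat_pCauchy p)"
proof
  fix X assume X: "X \<in> rat_pnull p"
  show "X \<in> carrier (rat_pCauchy p)"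
  proof (rule rat_pCauchyI)
    fix e :: real assume e: "e > 0"
    obtain N where N: "\<And>n. n \<ge> N \<Longrightarrow> rat_pabs p (X n) < e"
      using X e by (auto simp: rat_pnull_iff)
    have "rat_pabs p (X m - X n) < e" if "m \<ge> N" "n \<ge> N" for m n
      using rat_pabs_add_le_max[OF p, of "X m" "- X n"] N[of m] N[of n] that
      by (simp add: rat_pabs_minus[OF p])
    thus "\<exists>N. \<forall>m\<ge>N. \<forall>n\<ge>N. rat_pabs p (X m - X n) < e" by blast
  qed
qed

lemma rat_pnull_mult:
  assumes p: "prime p" and X: "X \<in> rat_pnull p" and Y: "Y \<in> carrier (rat_pCauchy p)"
  shows "(\<lambda>n. X n * Y n) \<in> rat_pnull p"
proof -
  obtain B where B: "\<And>n. rat_pabs p (Y n) \<le> B" using rat_pCauchy_bounded[OF p Y] by blast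
  have "(\<lambda>n. rat_pabs p (X n)) \<longlonglongrightarrow> 0" using X by (simp add: rat_pnull_def)
  hence "(\<lambda>n. rat_pabs p (X n) * B) \<longlonglongrightarrow> 0" by (rule tendsto_mult_left_zero)
  hence "(\<lambda>n. rat_pabs p (X n) * rat_pabs p (Y n)) \<longlonglongrightarrow> 0"
    by (rule Lim_null_comparison[rotated])
       (auto simp: abs_mult rat_pabs_nonneg intro!: always_eventually mult_left_mono B)
  thus ?thesis by (simp add: rat_pnull_def rat_pabs_mult[OF p])
qed

lemma ideal_rat_pnull:
  assumes p: "prime p" shows "ideal (rat_pnull p) (rat_pCauchy p)"
proof -
  interpret cring "rat_pCauchy p" by (rule cring_rat_pCauchy[OF p])
  have m: "\<ominus>\<^bsub>rat_pCauchy p\<^esub> X = (\<lambda>n. - X n)" if X: "X \<in> carrier (rat_pCauchy p)" for X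
    by (rule minus_equality[OF _ X rat_pCauchy_minus[OF p X]]) simp
  show ?thesis
  proof (rule idealI)
    show "subgroup (rat_pnull p) (add_monoid (rat_pCauchy p))"
    proof (rule add.subgroupI)
      show "rat_pnull p \<noteq> {}" by (auto simp: rat_pnull_def intro!: exI[of _ "\<lambda>n. 0"])
    next
      fix X assume X: "X \<in> rat_pnull p"
      thus "\<ominus>\<^bsub>rat_pCauchy p\<^esub> X \<in> rat_pnull p"
        using rat_pnull_subset[OF p] by (subst m) (auto simp: rat_pnull_def rat_pabs_minus[OF p])
    next
      fix X Y assume "X \<in> rat_pnull p" "Y \<in> rat_pnull p"
      hence "(\<lambda>n. rat_pabs p (X n) + rat_pabs p (Y n)) \<longlonglongrightarrow> 0"
        unfolding rat_pnull_def using tendsto_add[of _ 0 sequentially _ 0] by auto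
      hence "(\<lambda>n. rat_pabs p (X n + Y n)) \<longlonglongrightarrow> 0"
        by (rule tendsto_sandwich[OF _ _ tendsto_const, rotated 2])
           (auto simp: rat_pabs_nonneg rat_pabs_triangle[OF p])
      thus "X \<oplus>\<^bsub>rat_pCauchy p\<^esub> Y \<in> rat_pnull p" by (simp add: rat_pnull_def)
    qed (use rat_pnull_subset[OF p] in auto)
  next
    fix X Y assume XY: "X \<in> rat_pnull p" "Y \<in> carrier (rat_pCauchy p)"
    show "X \<otimes>\<^bsub>rat_pCauchy p\<^esub> Y \<in> rat_pnull p" using rat_pnull_mult[OF p XY] by simp
    show "Y \<otimes>\<^bsub>rat_pCauchy p\<^esub> X \<in> rat_pnull p"
      using rat_pnull_mult[OF p XY] by (simp add: mult.commute)
  qed (rule ring_axioms)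
qed

lemma rat_pCauchy_inverse:
  assumes p: "prime p" and X: "X \<in> carrier (rat_pCauchy p)" and X0: "X \<notin> rat_pnull p"
  shows "(\<lambda>n. inverse (X n)) \<in> carrier (rat_pCauchy p)"
        "(\<lambda>n. X n * inverse (X n) - 1) \<in> rat_pnull p"
proof -
  obtain L where L: "(\<lambda>n. rat_pabs p (X n)) \<longlonglongrightarrow> L"
    using rat_pCauchy_convergent[OF p X] by (auto simp: convergent_def)
  have "L \<ge> 0" by (rule LIMSEQ_le_const[OF L]) (auto simp: rat_pabs_nonneg)
  moreover have "L \<noteq> 0" using L X0 by (auto simp: rat_pnull_def)
  ultimately have L0: "L > 0" by simp
  define c where "c = L / 2"
  have c: "c > 0" "c < L" using L0 by (auto simp: c_def)
  obtain M where M: "\<And>n. n \<ge> M \<Longrightarrow> rat_pabs p (X n) > c"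
    using order_tendstoD(1)[OF L c(2)] by (auto simp: eventually_sequentially)
  have nz: "X n \<noteq> 0" if "n \<ge> M" for n using M[OF that] c by auto
  show "(\<lambda>n. inverse (X n)) \<in> carrier (rat_pCauchy p)"
  proof (rule rat_pCauchyI)
    fix e :: real assume e: "e > 0"
    obtain N where N: "\<And>m n. m \<ge> N \<Longrightarrow> n \<ge> N \<Longrightarrow> rat_pabs p (X m - X n) < e * (c * c)"
      using rat_pCauchyD[OF X, of "e * (c * c)"] e c by auto
    have "rat_pabs p (inverse (X m) - inverse (X n)) < e" if mn: "m \<ge> max M N" "n \<ge> max M N" for m n
    proof -
      have z: "X m \<noteq> 0" "X n \<noteq> 0" using nz mn by auto
      have "c * c < rat_pabs p (X m) * rat_pabs p (X n)"
        using M[of m] M[of n] c mn by (intro mult_strict_mono) auto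
      hence cc: "e * (c * c) < e * (rat_pabs p (X m) * rat_pabs p (X n))"
        and pos: "0 < rat_pabs p (X m) * rat_pabs p (X n)"
        using e c by (auto intro: less_trans[of 0 "c * c"])
      have "inverse (X m) - inverse (X n) = (X n - X m) * inverse (X m * X n)"
        using z by (simp add: field_simps)
      hence "rat_pabs p (inverse (X m) - inverse (X n)) =
          rat_pabs p (X n - X m) / (rat_pabs p (X m) * rat_pabs p (X n))"
        by (simp only: rat_pabs_mult[OF p] rat_pabs_inverse[OF p]) (simp add: divide_inverse)
      also have "\<dots> < e"
        using N[of n m] mn cc pos by (simp add: pos_divide_less_eq)
      finally show ?thesis .
    qed
    thus "\<exists>N. \<forall>m\<ge>N. \<forall>n\<ge>N. rat_pabs p (inverse (X m) - inverse (X n)) < e" by blast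
  qed
  show "(\<lambda>n. X n * inverse (X n) - 1) \<in> rat_pnull p"
    unfolding rat_pnull_iff using nz by (auto intro!: exI[of _ M])
qed

lemma Qp_cosets:
  assumes p: "prime p"
  shows "carrier (Qp p) = (\<lambda>X. rat_pnull p +>\<^bsub>rat_pCauchy p\<^esub> X) ` carrier (rat_pCauchy p)"
  by (auto simp: Qp_def FactRing_def A_RCOSETS_def')

lemma mem_coset_iff:
  assumes p: "prime p"
  shows "Y \<in> rat_pnull p +>\<^bsub>rat_pCauchy p\<^esub> X \<longleftrightarrow> (\<lambda>n. Y n - X n) \<in> rat_pnull p"
proof -
  have "Y \<in> rat_pnull p +>\<^bsub>rat_pCauchy p\<^esub> X \<longleftrightarrow> (\<exists>Z\<in>rat_pnull p. Y = (\<lambda>n. Z n + X n))"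
    by (auto simp: a_r_coset_def')
  also have "\<dots> \<longleftrightarrow> (\<lambda>n. Y n - X n) \<in> rat_pnull p"
    by (auto simp: fun_eq_iff intro!: bexI[of _ "\<lambda>n. Y n - X n"])
  finally show ?thesis .
qed

lemma coset_eq_iff:
  assumes p: "prime p" and X: "X \<in> carrier (rat_pCauchy p)" and Y: "Y \<in> carrier (rat_pCauchy p)"
  shows "rat_pnull p +>\<^bsub>rat_pCauchy p\<^esub> X = rat_pnull p +>\<^bsub>rat_pCauchy p\<^esub> Y \<longleftrightarrow>
         (\<lambda>n. X n - Y n) \<in> rat_pnull p"
proof -
  interpret ideal "rat_pnull p" "rat_pCauchy p" by (rule ideal_rat_pnull[OF p])
  show ?thesis
  proof
    assume "rat_pnull p +>\<^bsub>rat_pCauchy p\<^esub> X = rat_pnull p +>\<^bsub>rat_pCauchy p\<^esub> Y"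
    thus "(\<lambda>n. X n - Y n) \<in> rat_pnull p" using a_rcos_self[OF X] mem_coset_iff[OF p] by blast
  next
    assume "(\<lambda>n. X n - Y n) \<in> rat_pnull p"
    hence "X \<in> rat_pnull p +>\<^bsub>rat_pCauchy p\<^esub> Y" using mem_coset_iff[OF p] by blast
    from a_repr_independence[OF this Y a_subgroup]
    show "rat_pnull p +>\<^bsub>rat_pCauchy p\<^esub> X = rat_pnull p +>\<^bsub>rat_pCauchy p\<^esub> Y" by (rule sym)
  qed
qed

theorem field_Qp:
  assumes p: "prime p" shows "field (Qp p)"
proof -
  interpret I: ideal "rat_pnull p" "rat_pCauchy p" by (rule ideal_rat_pnull[OF p])
  interpret Q: cring "Qp p"
    unfolding Qp_def by (rule I.quotient_is_cring[OF cring_rat_pCauchy[OF p]])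
  let ?c = "\<lambda>X. rat_pnull p +>\<^bsub>rat_pCauchy p\<^esub> X"
  have zero: "\<zero>\<^bsub>Qp p\<^esub> = ?c (\<lambda>n. 0)"
    using mem_coset_iff[OF p, of _ "\<lambda>n. 0"] by (auto simp: Qp_def FactRing_def)
  have one: "\<one>\<^bsub>Qp p\<^esub> = ?c (\<lambda>n. 1)" by (simp add: Qp_def FactRing_def)
  show ?thesis
  proof (rule Q.cring_fieldI2)
    show "\<zero>\<^bsub>Qp p\<^esub> \<noteq> \<one>\<^bsub>Qp p\<^esub>"
      unfolding zero one coset_eq_iff[OF p rat_pCauchy_const rat_pCauchy_const]
      by (simp add: rat_pnull_def rat_pabs_minus[OF p] rat_pabs_1 LIMSEQ_const_iff)
  next
    fix a assume a: "a \<in> carrier (Qp p)" "a \<noteq> \<zero>\<^bsub>Qp p\<^esub>"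
    then obtain X where X: "X \<in> carrier (rat_pCauchy p)" "a = ?c X"
      by (auto simp: Qp_cosets[OF p])
    have X0: "X \<notin> rat_pnull p"
      using a X coset_eq_iff[OF p X(1) rat_pCauchy_const[of 0]] zero by auto
    note i = rat_pCauchy_inverse[OF p X(1) X0]
    have "a \<otimes>\<^bsub>Qp p\<^esub> ?c (\<lambda>n. inverse (X n)) = ?c (\<lambda>n. X n * inverse (X n))"
      using I.rcoset_mult_add[OF X(1) i(1)] X by (simp add: Qp_def FactRing_def)
    also have "\<dots> = \<one>\<^bsub>Qp p\<^esub>"
      unfolding one using i(2) coset_eq_iff[OF p rat_pCauchy_mult[OF p X(1) i(1)] rat_pCauchy_const]
      by simp
    finally show "\<exists>b\<in>carrier (Qp p). a \<otimes>\<^bsub>Qp p\<^esub> b = \<one>\<^bsub>Qp p\<^esub>"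
      using i(1) by (auto simp: Qp_cosets[OF p])
  qed
qed

lemma pabs_tendsto:
  assumes p: "prime p" and x: "x \<in> carrier (Qp p)" and X: "X \<in> x"
  shows "(\<lambda>n. rat_pabs p (X n)) \<longlonglongrightarrow> pabs p x"
proof -
  obtain Y where Y: "Y \<in> carrier (rat_pCauchy p)" "x = rat_pnull p +>\<^bsub>rat_pCauchy p\<^esub> Y"
    using x by (auto simp: Qp_cosets[OF p])
  obtain c where c: "(\<lambda>n. rat_pabs p (Y n)) \<longlonglongrightarrow> c"
    using rat_pCauchy_convergent[OF p Y(1)] by (auto simp: convergent_def)
  have all: "(\<lambda>n. rat_pabs p (Z n)) \<longlonglongrightarrow> c" if Z: "Z \<in> x" for Z
  proof -
    have "(\<lambda>n. rat_pabs p (Z n - Y n)) \<longlonglongrightarrow> 0"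
      using Z Y mem_coset_iff[OF p] by (auto simp: rat_pnull_def)
    hence "(\<lambda>n. rat_pabs p (Z n) - rat_pabs p (Y n)) \<longlonglongrightarrow> 0"
      by (rule Lim_null_comparison[rotated]) (auto simp: rat_pabs_abs_diff[OF p])
    from tendsto_add[OF this c] show ?thesis by simp
  qed
  have "pabs p x = c"
    unfolding pabs_def using all X by (intro the_equality) (auto intro: LIMSEQ_unique)
  thus ?thesis using all[OF X] by simp
qed

lemma Qp_rep:
  assumes p: "prime p" and x: "x \<in> carrier (Qp p)"
  obtains X where "X \<in> carrier (rat_pCauchy p)" "X \<in> x" "x = rat_pnull p +>\<^bsub>rat_pCauchy p\<^esub> X"
proof -
  interpret ideal "rat_pnull p" "rat_pCauchy p" by (rule ideal_rat_pnull[OF p])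
  show ?thesis using x that a_rcos_self by (auto simp: Qp_cosets[OF p])
qed

lemma pabs_rep:
  assumes p: "prime p" and X: "X \<in> carrier (rat_pCauchy p)"
  shows "(\<lambda>n. rat_pabs p (X n)) \<longlonglongrightarrow> pabs p (rat_pnull p +>\<^bsub>rat_pCauchy p\<^esub> X)"
proof -
  interpret ideal "rat_pnull p" "rat_pCauchy p" by (rule ideal_rat_pnull[OF p])
  show ?thesis using X a_rcos_self[OF X] by (intro pabs_tendsto[OF p]) (auto simp: Qp_cosets[OF p])
qed

lemma pabs_nonneg:
  assumes p: "prime p" and x: "x \<in> carrier (Qp p)" shows "pabs p x \<ge> 0"
proof -
  obtain X where "X \<in> x" using Qp_rep[OF p x] .
  from pabs_tendsto[OF p x this] show ?thesis
    by (rule LIMSEQ_le_const) (auto simp: rat_pabs_nonneg)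
qed

lemma Qp_zero: "prime p \<Longrightarrow> \<zero>\<^bsub>Qp p\<^esub> = rat_pnull p +>\<^bsub>rat_pCauchy p\<^esub> (\<lambda>n. 0)"
  using mem_coset_iff[of p _ "\<lambda>n. 0"] by (auto simp: Qp_def FactRing_def)

lemma Qp_add_cosets:
  assumes p: "prime p" and "X \<in> carrier (rat_pCauchy p)" "Y \<in> carrier (rat_pCauchy p)"
  shows "(rat_pnull p +>\<^bsub>rat_pCauchy p\<^esub> X) \<oplus>\<^bsub>Qp p\<^esub> (rat_pnull p +>\<^bsub>rat_pCauchy p\<^esub> Y) =
         rat_pnull p +>\<^bsub>rat_pCauchy p\<^esub> (\<lambda>n. X n + Y n)"
proof -
  interpret ideal "rat_pnull p" "rat_pCauchy p" by (rule ideal_rat_pnull[OF p])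
  show ?thesis using a_rcos_sum[OF assms(2,3)] by (simp add: Qp_def FactRing_def)
qed

lemma Qp_mult_cosets:
  assumes p: "prime p" and "X \<in> carrier (rat_pCauchy p)" "Y \<in> carrier (rat_pCauchy p)"
  shows "(rat_pnull p +>\<^bsub>rat_pCauchy p\<^esub> X) \<otimes>\<^bsub>Qp p\<^esub> (rat_pnull p +>\<^bsub>rat_pCauchy p\<^esub> Y) =
         rat_pnull p +>\<^bsub>rat_pCauchy p\<^esub> (\<lambda>n. X n * Y n)"
proof -
  interpret ideal "rat_pnull p" "rat_pCauchy p" by (rule ideal_rat_pnull[OF p])
  show ?thesis using rcoset_mult_add[OF assms(2,3)] by (simp add: Qp_def FactRing_def)
qed

lemma Qp_minus_coset:
  assumes p: "prime p" and X: "X \<in> carrier (rat_pCauchy p)"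
  shows "\<ominus>\<^bsub>Qp p\<^esub> (rat_pnull p +>\<^bsub>rat_pCauchy p\<^esub> X) = rat_pnull p +>\<^bsub>rat_pCauchy p\<^esub> (\<lambda>n. - X n)"
proof -
  interpret field "Qp p" by (rule field_Qp[OF p])
  show ?thesis
    by (rule minus_equality)
       (auto simp: Qp_add_cosets[OF p rat_pCauchy_minus[OF p X] X] Qp_zero[OF p]
          Qp_cosets[OF p] X rat_pCauchy_minus[OF p X])
qed

lemma pabs_eq_0_iff:
  assumes p: "prime p" and x: "x \<in> carrier (Qp p)"
  shows "pabs p x = 0 \<longleftrightarrow> x = \<zero>\<^bsub>Qp p\<^esub>"
proof -
  obtain X where X: "X \<in> carrier (rat_pCauchy p)" "x = rat_pnull p +>\<^bsub>rat_pCauchy p\<^esub> X"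
    using Qp_rep[OF p x] by metis
  have "pabs p x = 0 \<longleftrightarrow> X \<in> rat_pnull p"
    using pabs_rep[OF p X(1)] X(2) LIMSEQ_unique by (auto simp: rat_pnull_def)
  thus ?thesis
    using coset_eq_iff[OF p X(1) rat_pCauchy_const[of 0]] X(2) by (simp add: Qp_zero[OF p])
qed

lemma pabs_mult:
  assumes p: "prime p" and x: "x \<in> carrier (Qp p)" and y: "y \<in> carrier (Qp p)"
  shows "pabs p (x \<otimes>\<^bsub>Qp p\<^esub> y) = pabs p x * pabs p y"
proof -
  obtain X where X: "X \<in> carrier (rat_pCauchy p)" "x = rat_pnull p +>\<^bsub>rat_pCauchy p\<^esub> X"
    using Qp_rep[OF p x] by metis
  obtain Y where Y: "Y \<in> carrier (rat_pCauchy p)" "y = rat_pnull p +>\<^bsub>rat_pCauchy p\<^esub> Y"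
    using Qp_rep[OF p y] by metis
  have "(\<lambda>n. rat_pabs p (X n) * rat_pabs p (Y n)) \<longlonglongrightarrow> pabs p x * pabs p y"
    using pabs_rep[OF p X(1)] pabs_rep[OF p Y(1)] X Y by (auto intro: tendsto_mult)
  moreover have "(\<lambda>n. rat_pabs p (X n * Y n)) \<longlonglongrightarrow> pabs p (x \<otimes>\<^bsub>Qp p\<^esub> y)"
    using pabs_rep[OF p rat_pCauchy_mult[OF p X(1) Y(1)]] Qp_mult_cosets[OF p X(1) Y(1)] X Y by simp
  ultimately show ?thesis by (simp add: rat_pabs_mult[OF p] LIMSEQ_unique)
qed

lemma pabs_minus:
  assumes p: "prime p" and x: "x \<in> carrier (Qp p)"
  shows "pabs p (\<ominus>\<^bsub>Qp p\<^esub> x) = pabs p x"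
proof -
  obtain X where X: "X \<in> carrier (rat_pCauchy p)" "x = rat_pnull p +>\<^bsub>rat_pCauchy p\<^esub> X"
    using Qp_rep[OF p x] by metis
  show ?thesis
    using pabs_rep[OF p X(1)] pabs_rep[OF p rat_pCauchy_minus[OF p X(1)]] X
    by (simp add: Qp_minus_coset[OF p X(1)] rat_pabs_minus[OF p] LIMSEQ_unique)
qed

lemma pabs_add_le_max:
  assumes p: "prime p" and x: "x \<in> carrier (Qp p)" and y: "y \<in> carrier (Qp p)"
  shows "pabs p (x \<oplus>\<^bsub>Qp p\<^esub> y) \<le> max (pabs p x) (pabs p y)"
proof -
  obtain X where X: "X \<in> carrier (rat_pCauchy p)" "x = rat_pnull p +>\<^bsub>rat_pCauchy p\<^esub> X"
    using Qp_rep[OF p x] by metis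
  obtain Y where Y: "Y \<in> carrier (rat_pCauchy p)" "y = rat_pnull p +>\<^bsub>rat_pCauchy p\<^esub> Y"
    using Qp_rep[OF p y] by metis
  have "(\<lambda>n. max (rat_pabs p (X n)) (rat_pabs p (Y n))) \<longlonglongrightarrow> max (pabs p x) (pabs p y)"
    using pabs_rep[OF p X(1)] pabs_rep[OF p Y(1)] X Y by (auto intro: tendsto_max)
  moreover have "(\<lambda>n. rat_pabs p (X n + Y n)) \<longlonglongrightarrow> pabs p (x \<oplus>\<^bsub>Qp p\<^esub> y)"
    using pabs_rep[OF p rat_pCauchy_add[OF p X(1) Y(1)]] Qp_add_cosets[OF p X(1) Y(1)] X Y by simp
  ultimately show ?thesis
    using rat_pabs_add_le_max[OF p] by (intro LIMSEQ_le) auto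
qed

theorem Metric_space_Qp:
  assumes p: "prime p" shows "Metric_space (carrier (Qp p)) (pdist p)"
proof -
  interpret field "Qp p" by (rule field_Qp[OF p])
  show ?thesis
  proof
    fix x y
    show "0 \<le> pdist p x y" by (simp add: pdist_def pabs_nonneg[OF p])
    show "pdist p x y = pdist p y x"
      using pabs_minus[OF p, of "x \<ominus>\<^bsub>Qp p\<^esub> y"] minus_add[of x "\<ominus>\<^bsub>Qp p\<^esub> y"]
      by (auto simp: pdist_def a_minus_def minus_minus a_comm)
  next
    fix x y assume xy: "x \<in> carrier (Qp p)" "y \<in> carrier (Qp p)"
    hence "x = (x \<ominus>\<^bsub>Qp p\<^esub> y) \<oplus>\<^bsub>Qp p\<^esub> y" "x \<ominus>\<^bsub>Qp p\<^esub> x = \<zero>\<^bsub>Qp p\<^esub>" by algebra+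
    hence "x \<ominus>\<^bsub>Qp p\<^esub> y = \<zero>\<^bsub>Qp p\<^esub> \<longleftrightarrow> x = y" using xy by auto
    thus "pdist p x y = 0 \<longleftrightarrow> x = y" using xy by (simp add: pdist_def pabs_eq_0_iff[OF p])
  next
    fix x y z assume xyz: "x \<in> carrier (Qp p)" "y \<in> carrier (Qp p)" "z \<in> carrier (Qp p)"
    have "x \<ominus>\<^bsub>Qp p\<^esub> z = (x \<ominus>\<^bsub>Qp p\<^esub> y) \<oplus>\<^bsub>Qp p\<^esub> (y \<ominus>\<^bsub>Qp p\<^esub> z)"
      using xyz by algebra
    hence "pabs p (x \<ominus>\<^bsub>Qp p\<^esub> z) \<le> max (pabs p (x \<ominus>\<^bsub>Qp p\<^esub> y)) (pabs p (y \<ominus>\<^bsub>Qp p\<^esub> z))"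
      using xyz by (simp add: pabs_add_le_max[OF p])
    thus "pdist p x z \<le> pdist p x y + pdist p y z"
      using xyz pabs_nonneg[OF p, of "x \<ominus>\<^bsub>Qp p\<^esub> y"] pabs_nonneg[OF p, of "y \<ominus>\<^bsub>Qp p\<^esub> z"]
      by (simp add: pdist_def)
  qed
qed


section \<open>Haar measure, block spaces and the operator\<close>

text \<open>Normalized Haar measure on the Borel sets of the additive group.\<close>

definition is_haar_Qp :: "nat \<Rightarrow> (nat \<Rightarrow> rat) set measure \<Rightarrow> bool" where
  "is_haar_Qp p M \<longleftrightarrow>
     sets M = sets (sigma (carrier (Qp p)) {U. openin (ptop p) U}) \<and>
     (\<forall>a\<in>carrier (Qp p). \<forall>E\<in>sets M. emeasure M ((\<lambda>x. a \<oplus>\<^bsub>Qp p\<^esub> x) ` E) = emeasure M E) \<and>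
     emeasure M {x \<in> carrier (Qp p). pabs p x \<le> 1} = 1"

definition star_measure :: "nat \<Rightarrow> (nat \<Rightarrow> rat) set measure \<Rightarrow> (nat \<Rightarrow> rat) set measure" where
  "star_measure p M = restrict_space M (Qp_star p)"

definition in_Lr :: "real \<Rightarrow> 'a measure \<Rightarrow> ('a \<Rightarrow> complex) \<Rightarrow> bool" where
  "in_Lr r N f \<longleftrightarrow> f \<in> borel_measurable N \<and> integrable N (\<lambda>x. cmod (f x) powr r)"

definition Lr_norm :: "real \<Rightarrow> 'a measure \<Rightarrow> ('a \<Rightarrow> complex) \<Rightarrow> real" where
  "Lr_norm r N f = (\<integral>x. cmod (f x) powr r \<partial>N) powr (1 / r)"

text \<open>Local means: on compact subsets of the punctured line, so nothing is required near 0.\<close>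

definition in_Lr_loc ::
  "nat \<Rightarrow> (nat \<Rightarrow> rat) set measure \<Rightarrow> real \<Rightarrow> ((nat \<Rightarrow> rat) set \<Rightarrow> complex) \<Rightarrow> bool" where
  "in_Lr_loc p M r f \<longleftrightarrow>
     f \<in> borel_measurable (star_measure p M) \<and>
     (\<forall>E. compactin (subtopology (ptop p) (Qp_star p)) E \<longrightarrow>
          set_integrable (star_measure p M) E (\<lambda>x. cmod (f x) powr r))"

definition central_block ::
  "nat \<Rightarrow> (nat \<Rightarrow> rat) set measure \<Rightarrow> real \<Rightarrow> real \<Rightarrow> ((nat \<Rightarrow> rat) set \<Rightarrow> complex) \<Rightarrow> bool" where
  "central_block p M r \<alpha> a \<longleftrightarrow>
     (\<exists>n::int. (\<forall>x\<in>Qp_star p. a x \<noteq> 0 \<longrightarrow> x \<in> pball p n) \<and>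
        in_Lr r (star_measure p M) a \<and>
        Lr_norm r (star_measure p M) a \<le> measure M (pball p n) powr (- \<alpha>))"

definition block_decomp ::
  "nat \<Rightarrow> (nat \<Rightarrow> rat) set measure \<Rightarrow> real \<Rightarrow> real \<Rightarrow> ((nat \<Rightarrow> rat) set \<Rightarrow> complex) \<Rightarrow>
   (nat \<Rightarrow> complex) \<Rightarrow> (nat \<Rightarrow> (nat \<Rightarrow> rat) set \<Rightarrow> complex) \<Rightarrow> bool" where
  "block_decomp p M r \<alpha> f c a \<longleftrightarrow>
     summable (\<lambda>k. cmod (c k)) \<and> (\<forall>k. central_block p M r \<alpha> (a k)) \<and>
     (AE x in star_measure p M. (\<lambda>k. c k * a k x) sums f x)"

definition block_space ::
  "nat \<Rightarrow> (nat \<Rightarrow> rat) set measure \<Rightarrow> real \<Rightarrow> real \<Rightarrow> ((nat \<Rightarrow> rat) set \<Rightarrow> complex) set" where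
  "block_space p M r \<alpha> = {f. in_Lr_loc p M r f \<and> (\<exists>c a. block_decomp p M r \<alpha> f c a)}"

definition block_norm ::
  "nat \<Rightarrow> (nat \<Rightarrow> rat) set measure \<Rightarrow> real \<Rightarrow> real \<Rightarrow> ((nat \<Rightarrow> rat) set \<Rightarrow> complex) \<Rightarrow> real" where
  "block_norm p M r \<alpha> f = Inf {(\<Sum>k. cmod (c k)) | c a. block_decomp p M r \<alpha> f c a}"

definition hardy_hilbert ::
  "nat \<Rightarrow> (nat \<Rightarrow> rat) set measure \<Rightarrow> (real \<Rightarrow> real \<Rightarrow> real) \<Rightarrow>
   ((nat \<Rightarrow> rat) set \<Rightarrow> complex) \<Rightarrow> (nat \<Rightarrow> rat) set \<Rightarrow> complex" where
  "hardy_hilbert p M K f x =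
     (\<integral>y. complex_of_real (K (pabs p x) (pabs p y)) * f y \<partial>star_measure p M)"

end

(* Writing A_i f(x) = |x|^-1 * (integral of f over the sphere |y| = p^i |x|), homogeneity of the kernel
   gives T f = sum_i K(1,p^i) A_i f.  If a is a block supported in B^n, then A_i a is supported in
   B^(n-i), and Hoelder's inequality on each sphere shows that it is (1 - 1/p) p^(-i(1/r+alpha-1))
   times a block.  Applying this to every term of a block decomposition of f yields a block
   decomposition of T f whose coefficients sum to C/2 times those of f.  All interchanges
   of sums and integrals are justified at every single point, because the integral of a block over
   the sphere of radius p^j is at most p^(-j(1/r+alpha-1)), uniformly in the block. *)
theory Submission
  imports Defs "HOL-Number_Theory.Cong"
begin

section \<open>Spheres and balls of the p-adic numbers\<close>

text \<open>The analysis sees the line only through the sphere measures (1 - 1/p) p^j, so it is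
  carried out in the locale \<open>spheres\<close> for a map \<open>v\<close> to the integers; the
  p-adic work derives these measures from translation invariance and the normalisation of the unit
  ball. The exponent \<beta> = 1/r + \<alpha> - 1 balances Hoelder's factor p^(j(1 - 1/r)) on the
  sphere of radius p^j against the block bound p^(-\<alpha> n) <= p^(-\<alpha> j), valid for j <= n.
  The obstacle is that a decomposition of f converges only almost everywhere and perhaps
  conditionally, whereas T f has to be expanded over two indices, block and sphere. For a fixed y a
  single sphere contributes, so wherever the double series converges absolutely it collapses to the
  given series of f(y). Local integrability of T f is cheap: T f is constant on spheres, and a
  compact subset of the punctured line meets only finitely many of them.\<close>

lemma powi_eq_powr: "0 < q \<Longrightarrow> (q::real) powi k = q powr of_int k"
  by (simp add: powr_real_of_int')

definition Qp_of_rat :: "nat \<Rightarrow> rat \<Rightarrow> (nat \<Rightarrow> rat) set" where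
  "Qp_of_rat p c = rat_pnull p +>\<^bsub>rat_pCauchy p\<^esub> (\<lambda>n. c)"

lemma Qp_of_rat_carrier: "prime p \<Longrightarrow> Qp_of_rat p c \<in> carrier (Qp p)"
  by (simp add: Qp_of_rat_def Qp_cosets rat_pCauchy_const)

lemma Qp_minus_cosets:
  assumes p: "prime p" and X: "X \<in> carrier (rat_pCauchy p)" and Y: "Y \<in> carrier (rat_pCauchy p)"
  shows "(rat_pnull p +>\<^bsub>rat_pCauchy p\<^esub> X) \<ominus>\<^bsub>Qp p\<^esub> (rat_pnull p +>\<^bsub>rat_pCauchy p\<^esub> Y) =
         rat_pnull p +>\<^bsub>rat_pCauchy p\<^esub> (\<lambda>n. X n - Y n)"
  using Qp_add_cosets[OF p X rat_pCauchy_minus[OF p Y]]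
  by (simp add: a_minus_def Qp_minus_coset[OF p Y])

lemma Qp_of_rat_diff:
  "prime p \<Longrightarrow> Qp_of_rat p b \<ominus>\<^bsub>Qp p\<^esub> Qp_of_rat p c = Qp_of_rat p (b - c)"
  by (simp add: Qp_of_rat_def Qp_minus_cosets rat_pCauchy_const)

lemma pabs_Qp_of_rat:
  assumes p: "prime p" shows "pabs p (Qp_of_rat p c) = rat_pabs p c"
  using pabs_rep[OF p rat_pCauchy_const[of c]] by (simp add: Qp_of_rat_def LIMSEQ_const_iff)

text \<open>A late enough entry of a representing Cauchy sequence is itself the approximating
  rational.\<close>

lemma Qp_of_rat_dense:
  assumes p: "prime p" and x: "x \<in> carrier (Qp p)" and e: "0 < e"
  obtains c where "pabs p (x \<ominus>\<^bsub>Qp p\<^esub> Qp_of_rat p c) < e"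
proof -
  obtain X where X: "X \<in> carrier (rat_pCauchy p)" "x = rat_pnull p +>\<^bsub>rat_pCauchy p\<^esub> X"
    using Qp_rep[OF p x] by metis
  \<comment> \<open>The bound is e/2 because passing to the limit only preserves a weak
    inequality.\<close>
  obtain N where N: "\<And>m n. m \<ge> N \<Longrightarrow> n \<ge> N \<Longrightarrow> rat_pabs p (X m - X n) < e / 2"
    using rat_pCauchyD[OF X(1), of "e / 2"] e by auto
  have C: "(\<lambda>n. X n - X N) \<in> carrier (rat_pCauchy p)"
    using rat_pCauchy_add[OF p X(1) rat_pCauchy_const[of "- X N"]] by simp
  have "pabs p (x \<ominus>\<^bsub>Qp p\<^esub> Qp_of_rat p (X N)) \<le> e / 2"
    unfolding X(2) Qp_of_rat_def Qp_minus_cosets[OF p X(1) rat_pCauchy_const]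
    by (rule LIMSEQ_le_const2[OF pabs_rep[OF p C]]) (use N in \<open>auto intro!: exI[of _ N] less_imp_le\<close>)
  then show ?thesis using that[of "X N"] e by linarith
qed

lemma pabs_minus_swap:
  assumes p: "prime p" and x: "x \<in> carrier (Qp p)" and y: "y \<in> carrier (Qp p)"
  shows "pabs p (x \<ominus>\<^bsub>Qp p\<^esub> y) = pabs p (y \<ominus>\<^bsub>Qp p\<^esub> x)"
  using Metric_space.commute[OF Metric_space_Qp[OF p], of x y] x y by (simp add: pdist_def)

lemma pabs_ultrametric:
  assumes p: "prime p" and "x \<in> carrier (Qp p)" "y \<in> carrier (Qp p)" "z \<in> carrier (Qp p)"
  shows "pabs p (x \<ominus>\<^bsub>Qp p\<^esub> z) \<le> max (pabs p (x \<ominus>\<^bsub>Qp p\<^esub> y)) (pabs p (y \<ominus>\<^bsub>Qp p\<^esub> z))"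
proof -
  interpret field "Qp p" by (rule field_Qp[OF p])
  have "x \<ominus>\<^bsub>Qp p\<^esub> z = (x \<ominus>\<^bsub>Qp p\<^esub> y) \<oplus>\<^bsub>Qp p\<^esub> (y \<ominus>\<^bsub>Qp p\<^esub> z)"
    using assms by algebra
  then show ?thesis using assms by (simp add: pabs_add_le_max[OF p])
qed

lemma Qp_minus_zero:
  assumes p: "prime p" and x: "x \<in> carrier (Qp p)" shows "x \<ominus>\<^bsub>Qp p\<^esub> \<zero>\<^bsub>Qp p\<^esub> = x"
proof -
  interpret field "Qp p" by (rule field_Qp[OF p])
  show ?thesis using x by algebra
qed

lemma pabs_le_max:
  assumes p: "prime p" and x: "x \<in> carrier (Qp p)" and y: "y \<in> carrier (Qp p)"
  shows "pabs p x \<le> max (pabs p (x \<ominus>\<^bsub>Qp p\<^esub> y)) (pabs p y)"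
proof -
  interpret field "Qp p" by (rule field_Qp[OF p])
  show ?thesis using pabs_ultrametric[OF p x y zero_closed] by (simp add: Qp_minus_zero[OF p] x y)
qed

text \<open>All p-adic triangles are isosceles: a perturbation smaller than |x| cannot change the
  absolute value.\<close>

lemma pabs_eqI:
  assumes p: "prime p" and x: "x \<in> carrier (Qp p)" and y: "y \<in> carrier (Qp p)"
    and lt: "pabs p (x \<ominus>\<^bsub>Qp p\<^esub> y) < pabs p x"
  shows "pabs p x = pabs p y"
  using pabs_le_max[OF p x y] pabs_le_max[OF p y x] pabs_minus_swap[OF p x y] lt by linarith

text \<open>The completion has no new absolute values: a rational closer to x than |x| has the same
  absolute value as x, and for rationals the claim is part of the definition.\<close>

lemma pabs_powi:
  assumes p: "prime p" and x: "x \<in> Qp_star p"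
  obtains k where "pabs p x = real p powi k"
proof -
  have x': "x \<in> carrier (Qp p)" and "0 < pabs p x"
    using x pabs_eq_0_iff[OF p] pabs_nonneg[OF p, of x] by (auto simp: less_le)
  then obtain c where c: "pabs p (x \<ominus>\<^bsub>Qp p\<^esub> Qp_of_rat p c) < pabs p x"
    using Qp_of_rat_dense[OF p x'] by blast
  have "pabs p x = rat_pabs p c"
    using pabs_eqI[OF p x' Qp_of_rat_carrier[OF p] c] by (simp add: pabs_Qp_of_rat[OF p])
  then show ?thesis using that \<open>0 < pabs p x\<close> by (auto simp: rat_pabs_def split: if_splits)
qed

text \<open>The p-adic valuation with reversed sign. On the punctured line the logarithm is already
  an integer, so the floor merely changes the type.\<close>

definition plog :: "nat \<Rightarrow> (nat \<Rightarrow> rat) set \<Rightarrow> int" where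
  "plog p x = \<lfloor>log (real p) (pabs p x)\<rfloor>"

lemma pabs_eq_plog:
  assumes p: "prime p" and x: "x \<in> Qp_star p"
  shows "pabs p x = real p powi plog p x"
proof -
  obtain k where k: "pabs p x = real p powi k" using pabs_powi[OF p x] .
  have "1 < real p" using prime_gt_1_nat[OF p] by simp
  then have "plog p x = k" by (simp add: plog_def k powi_eq_powr)
  then show ?thesis using k by simp
qed

lemma powi_le_iff: "1 < (q::real) \<Longrightarrow> q powi m \<le> q powi n \<longleftrightarrow> m \<le> n"
  by (simp add: powi_eq_powr)

lemma pball_iff_plog:
  assumes p: "prime p" and x: "x \<in> Qp_star p"
  shows "x \<in> pball p n \<longleftrightarrow> plog p x \<le> n"
  using x prime_gt_1_nat[OF p] by (simp add: pball_def pabs_eq_plog[OF p] powi_le_iff)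

text \<open>In an ultrametric space every point of a ball is a centre of it, so balls defined by a
  weak inequality are open too. This makes the balls B^n Borel sets.\<close>

lemma openin_ptop_cball:
  assumes p: "prime p" and a: "a \<in> carrier (Qp p)" and e: "0 < e"
  shows "openin (ptop p) {x \<in> carrier (Qp p). pabs p (x \<ominus>\<^bsub>Qp p\<^esub> a) \<le> e}"
proof -
  interpret Metric_space "carrier (Qp p)" "pdist p" by (rule Metric_space_Qp[OF p])
  have "mball x e \<subseteq> {x \<in> carrier (Qp p). pabs p (x \<ominus>\<^bsub>Qp p\<^esub> a) \<le> e}"
    if x: "x \<in> carrier (Qp p)" "pabs p (x \<ominus>\<^bsub>Qp p\<^esub> a) \<le> e" for x
  proof
    fix y assume "y \<in> mball x e"
    then have y: "y \<in> carrier (Qp p)" and "pabs p (y \<ominus>\<^bsub>Qp p\<^esub> x) < e"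
      using x by (auto simp: pdist_def pabs_minus_swap[OF p] split: if_splits)
    then show "y \<in> {x \<in> carrier (Qp p). pabs p (x \<ominus>\<^bsub>Qp p\<^esub> a) \<le> e}"
      using pabs_ultrametric[OF p y x(1) a] x by simp
  qed
  then show ?thesis using e by (auto simp: ptop_def openin_mtopology)
qed

lemma topspace_ptop: "prime p \<Longrightarrow> topspace (ptop p) = carrier (Qp p)"
  using Metric_space.topspace_mtopology[OF Metric_space_Qp] by (simp add: ptop_def)

lemma Hausdorff_ptop: "prime p \<Longrightarrow> Hausdorff_space (ptop p)"
  using Metric_space.Hausdorff_space_mtopology[OF Metric_space_Qp] by (simp add: ptop_def)

lemma openin_Qp_star:
  assumes p: "prime p" shows "openin (ptop p) (Qp_star p)"
proof -
  interpret field "Qp p" by (rule field_Qp[OF p])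
  have "closedin (ptop p) {\<zero>\<^bsub>Qp p\<^esub>}"
    using Hausdorff_imp_t1_space[OF Hausdorff_ptop[OF p]]
    by (simp add: t1_space_closedin_singleton topspace_ptop[OF p])
  then show ?thesis by (simp add: closedin_def topspace_ptop[OF p])
qed

section \<open>Haar measure: Borel sets and translated balls\<close>

locale haar_Qp =
  fixes p :: nat and M :: "(nat \<Rightarrow> rat) set measure"
  assumes p: "prime p" and haar: "is_haar_Qp p M"
begin

sublocale Qp: field "Qp p" by (rule field_Qp[OF p])

lemma p_gt_1: "1 < real p" using prime_gt_1_nat[OF p] by simp

lemma sets_haar: "sets M = sets (sigma (carrier (Qp p)) {U. openin (ptop p) U})"
  using haar by (simp add: is_haar_Qp_def)

lemma openin_sets: "openin (ptop p) U \<Longrightarrow> U \<in> sets M"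
  using topspace_ptop[OF p] openin_subset unfolding sets_haar
  by (subst sets_measure_of) (auto intro: sigma_sets.Basic)

lemma space_haar: "space M = carrier (Qp p)"
  using sets_eq_imp_space_eq[OF sets_haar] by (simp add: space_measure_of_conv)

lemma cball_sets:
  "a \<in> carrier (Qp p) \<Longrightarrow> {x \<in> carrier (Qp p). pabs p (x \<ominus>\<^bsub>Qp p\<^esub> a) \<le> real p powi n} \<in> sets M"
  using openin_ptop_cball[OF p] p_gt_1 by (intro openin_sets) simp

lemma pball_sets: "pball p n \<in> sets M"
  using cball_sets[of "\<zero>\<^bsub>Qp p\<^esub>" n] by (simp add: pball_def Qp_minus_zero[OF p] cong: conj_cong)

lemma translate_pball:
  assumes a: "a \<in> carrier (Qp p)"
  shows "(\<lambda>x. a \<oplus>\<^bsub>Qp p\<^esub> x) ` pball p n = {x \<in> carrier (Qp p). pabs p (x \<ominus>\<^bsub>Qp p\<^esub> a) \<le> real p powi n}"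
proof (intro equalityI subsetI)
  fix y assume "y \<in> (\<lambda>x. a \<oplus>\<^bsub>Qp p\<^esub> x) ` pball p n"
  then obtain x where x: "x \<in> carrier (Qp p)" "pabs p x \<le> real p powi n" "y = a \<oplus>\<^bsub>Qp p\<^esub> x"
    by (auto simp: pball_def)
  then have "y \<ominus>\<^bsub>Qp p\<^esub> a = x" using a by algebra
  then show "y \<in> {x \<in> carrier (Qp p). pabs p (x \<ominus>\<^bsub>Qp p\<^esub> a) \<le> real p powi n}"
    using a x by simp
next
  fix y assume y: "y \<in> {x \<in> carrier (Qp p). pabs p (x \<ominus>\<^bsub>Qp p\<^esub> a) \<le> real p powi n}"
  then have y': "y \<in> carrier (Qp p)" by simp
  have "y = a \<oplus>\<^bsub>Qp p\<^esub> (y \<ominus>\<^bsub>Qp p\<^esub> a)" using a y' by algebra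
  then show "y \<in> (\<lambda>x. a \<oplus>\<^bsub>Qp p\<^esub> x) ` pball p n"
    using a y by (intro image_eqI[of _ _ "y \<ominus>\<^bsub>Qp p\<^esub> a"]) (auto simp: pball_def)
qed

lemma emeasure_cball:
  assumes a: "a \<in> carrier (Qp p)"
  shows "emeasure M {x \<in> carrier (Qp p). pabs p (x \<ominus>\<^bsub>Qp p\<^esub> a) \<le> real p powi n} = emeasure M (pball p n)"
  using haar a pball_sets[of n] unfolding is_haar_Qp_def translate_pball[OF a, symmetric] by blast

end

section \<open>Reduction of rationals modulo p\<close>

lemma rat_pabs_of_int:
  "prime p \<Longrightarrow> a \<noteq> 0 \<Longrightarrow> rat_pabs p (of_int a) = real p powi (- int (multiplicity (int p) a))"
  using rat_pabs_fract[of p a 1] by (simp add: multiplicity_unit_right)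

lemma rat_pabs_of_int_le_1:
  assumes p: "prime p" shows "rat_pabs p (of_int a) \<le> 1"
proof (cases "a = 0")
  case False
  then show ?thesis using prime_gt_1_nat[OF p] powi_le_iff[of "real p" _ 0]
    by (simp add: rat_pabs_of_int[OF p])
qed simp

lemma rat_pabs_of_int_eq_1:
  "prime p \<Longrightarrow> \<not> int p dvd a \<Longrightarrow> rat_pabs p (of_int a) = 1"
  by (cases "a = 0") (auto simp: rat_pabs_of_int not_dvd_imp_multiplicity_0)

lemma rat_pabs_of_nat_self:
  assumes p: "prime p" shows "rat_pabs p (of_nat p) = inverse (real p)"
proof -
  have "multiplicity (int p) (int p) = 1"
    using p by (intro multiplicity_self) (auto simp: prime_gt_0_nat)
  then show ?thesis using rat_pabs_of_int[OF p, of "int p"] prime_gt_0_nat[OF p]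
    by (simp add: power_int_minus)
qed

lemma rat_pabs_powi_self:
  assumes p: "prime p" shows "rat_pabs p (of_nat p powi m) = real p powi (- m)"
proof -
  have pow: "rat_pabs p (q ^ k) = rat_pabs p q ^ k" for q k
    by (induction k) (simp_all add: rat_pabs_1 rat_pabs_mult[OF p])
  show ?thesis
    by (auto simp: power_int_def pow rat_pabs_1 rat_pabs_of_nat_self[OF p] rat_pabs_inverse[OF p] power_inverse
        simp del: inverse_eq_divide)
qed

text \<open>In lowest terms q = a/b has b prime to p, so b has an inverse x modulo p and q reduces
  to j = a x mod p. Then q - j = (a - j b)/b has a numerator divisible by p.\<close>

lemma rat_residue:
  assumes p: "prime p" and q: "rat_pabs p q \<le> 1"
  obtains j where "j < p" "rat_pabs p (q - of_nat j) \<le> inverse (real p)"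
proof -
  obtain a b where ab: "quotient_of q = (a, b)" by fastforce
  have b0: "b \<noteq> 0" using quotient_of_denom_pos[OF ab] by simp
  have qab: "q = of_int a / of_int b" by (rule quotient_of_div[OF ab])
  have pb: "\<not> int p dvd b"
  proof
    \<comment> \<open>Otherwise coprimality gives |a| = 1 and |b| < 1, against |a| = |q| |b| <=
      |b|.\<close>
    assume b: "int p dvd b"
    have a: "\<not> int p dvd a"
      using b coprime_common_divisor[OF quotient_of_coprime[OF ab], of "int p"] prime_gt_1_nat[OF p] by auto
    then have "rat_pabs p (of_int a) = 1" and "a \<noteq> 0" by (auto simp: rat_pabs_of_int_eq_1[OF p])
    have "rat_pabs p (of_int b) < 1"
    proof -
      have "multiplicity (int p) b \<noteq> 0"
        using b b0 prime_gt_1_nat[OF p] by (subst multiplicity_eq_zero_iff) auto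
      then have "\<not> real p powi 0 \<le> rat_pabs p (of_int b)"
        unfolding rat_pabs_of_int[OF p b0] using prime_gt_1_nat[OF p] by (subst powi_le_iff) auto
      then show ?thesis by simp
    qed
    moreover have "rat_pabs p (of_int a) = rat_pabs p q * rat_pabs p (of_int b)"
      using b0 by (simp add: qab flip: rat_pabs_mult[OF p])
    ultimately show False
      using \<open>rat_pabs p (of_int a) = 1\<close> mult_right_mono[OF q rat_pabs_nonneg[of p "of_int b"]] by simp
  qed
  then have "coprime b (int p)"
    using prime_imp_coprime[of "int p" b] p by (simp add: ac_simps)
  then obtain x where x: "[b * x = 1] (mod int p)" using cong_solve_coprime_int by blast
  define j where "j = nat ((a * x) mod int p)"
  have j: "int j = (a * x) mod int p" "j < p"
    using prime_gt_0_nat[OF p] by (auto simp: j_def nat_less_iff)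
  have "[int j * b = a * (b * x)] (mod int p)"
    unfolding j by (simp add: cong_def mod_mult_left_eq mod_mult_right_eq mult_ac)
  also have "[a * (b * x) = a * 1] (mod int p)" using x by (rule cong_scalar_left)
  finally have "int p dvd a - int j * b" by (simp add: cong_iff_dvd_diff dvd_diff_commute[of _ a])
  then obtain c where c: "a - int j * b = int p * c" by (elim dvdE)
  have "q - of_nat j = of_nat p * (of_int c * inverse (of_int b))"
    using arg_cong[OF c, of "of_int :: int \<Rightarrow> rat"] b0 by (simp add: qab field_simps)
  then have "rat_pabs p (q - of_nat j) = inverse (real p) * rat_pabs p (of_int c)"
    by (simp only: rat_pabs_mult[OF p] rat_pabs_of_nat_self[OF p] rat_pabs_inverse[OF p]
        rat_pabs_of_int_eq_1[OF p pb]) simp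
  also have "\<dots> \<le> inverse (real p)"
    using rat_pabs_of_int_le_1[OF p, of c] by (simp add: mult_left_le)
  finally show ?thesis using that j by blast
qed

section \<open>The Haar measure of balls\<close>

context haar_Qp
begin

text \<open>The point j p^(-n). Since p^(-n) has absolute value p^n, these points with j < p
  represent the cosets of B^(n-1) in B^n.\<close>

definition residue :: "int \<Rightarrow> nat \<Rightarrow> (nat \<Rightarrow> rat) set" where
  "residue n j = Qp_of_rat p (of_nat j * of_nat p powi (- n))"

lemma residue_carrier: "residue n j \<in> carrier (Qp p)"
  by (simp add: residue_def Qp_of_rat_carrier[OF p])

lemma pabs_residue_diff:
  "pabs p (residue n i \<ominus>\<^bsub>Qp p\<^esub> residue n j) = rat_pabs p (of_int (int i - int j)) * real p powi n"
  by (simp add: residue_def Qp_of_rat_diff[OF p] pabs_Qp_of_rat[OF p] rat_pabs_mult[OF p]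
      rat_pabs_powi_self[OF p] flip: left_diff_distrib)

lemma pball_partition:
  "pball p n = (\<Union>j<p. {x \<in> carrier (Qp p). pabs p (x \<ominus>\<^bsub>Qp p\<^esub> residue n j) \<le> real p powi (n - 1)})"
proof (intro equalityI subsetI)
  fix x assume "x \<in> pball p n"
  then have x: "x \<in> carrier (Qp p)" "pabs p x \<le> real p powi n" by (auto simp: pball_def)
  \<comment> \<open>A rational within p^(n-1) of x lies in the same coset of B^(n-1), so it suffices
    to place c; multiplying by p^n moves c into the unit ball, where \<open>rat_residue\<close>
    applies.\<close>
  obtain c where c: "pabs p (x \<ominus>\<^bsub>Qp p\<^esub> Qp_of_rat p c) < real p powi (n - 1)"
    using Qp_of_rat_dense[OF p x(1), of "real p powi (n - 1)"] p_gt_1 by auto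
  have le: "real p powi (n - 1) \<le> real p powi n" using p_gt_1 by (simp add: powi_le_iff)
  have "rat_pabs p c \<le> real p powi n"
    using pabs_le_max[OF p Qp_of_rat_carrier[OF p] x(1), of c] x c le
      pabs_minus_swap[OF p x(1) Qp_of_rat_carrier[OF p], of c]
    by (simp add: pabs_Qp_of_rat[OF p])
  then have "rat_pabs p (c * of_nat p powi n) \<le> 1"
    using p_gt_1 by (simp add: rat_pabs_mult[OF p] rat_pabs_powi_self[OF p] power_int_minus field_simps)
  then obtain j where j: "j < p" "rat_pabs p (c * of_nat p powi n - of_nat j) \<le> inverse (real p)"
    using rat_residue[OF p] by blast
  have "c - of_nat j * of_nat p powi (- n) = (c * of_nat p powi n - of_nat j) * of_nat p powi (- n)"
    using p_gt_1 by (simp add: power_int_minus field_simps)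
  then have "pabs p (Qp_of_rat p c \<ominus>\<^bsub>Qp p\<^esub> residue n j)
      = rat_pabs p (c * of_nat p powi n - of_nat j) * real p powi n"
    by (simp add: residue_def Qp_of_rat_diff[OF p] pabs_Qp_of_rat[OF p] rat_pabs_mult[OF p]
      rat_pabs_powi_self[OF p])
  also have "\<dots> \<le> real p powi (n - 1)"
    using mult_right_mono[OF j(2), of "real p powi n"] p_gt_1 by (simp add: power_int_diff field_simps)
  finally have "pabs p (x \<ominus>\<^bsub>Qp p\<^esub> residue n j) \<le> real p powi (n - 1)"
    using pabs_ultrametric[OF p x(1) Qp_of_rat_carrier[OF p] residue_carrier] c by (smt (verit))
  then show "x \<in> (\<Union>j<p. {x \<in> carrier (Qp p). pabs p (x \<ominus>\<^bsub>Qp p\<^esub> residue n j) \<le> real p powi (n - 1)})"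
    using x j by auto
next
  fix x assume "x \<in> (\<Union>j<p. {x \<in> carrier (Qp p). pabs p (x \<ominus>\<^bsub>Qp p\<^esub> residue n j) \<le> real p powi (n - 1)})"
  then obtain j where x: "x \<in> carrier (Qp p)" "pabs p (x \<ominus>\<^bsub>Qp p\<^esub> residue n j) \<le> real p powi (n - 1)" by auto
  have "pabs p (residue n j) \<le> real p powi n"
    using rat_pabs_of_int_le_1[OF p, of "int j"] p_gt_1
    by (simp add: residue_def pabs_Qp_of_rat[OF p] rat_pabs_mult[OF p] rat_pabs_powi_self[OF p] mult_left_le_one_le rat_pabs_nonneg)
  moreover have "real p powi (n - 1) \<le> real p powi n" using p_gt_1 by (simp add: powi_le_iff)
  ultimately show "x \<in> pball p n"
    using pabs_le_max[OF p x(1) residue_carrier, of n j] x by (auto simp: pball_def)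
qed

text \<open>Distinct representatives are at distance exactly p^n, while two points within p^(n-1) of
  a common x are at distance at most p^(n-1).\<close>

lemma disjoint_residue_balls:
  "disjoint_family_on (\<lambda>j. {x \<in> carrier (Qp p). pabs p (x \<ominus>\<^bsub>Qp p\<^esub> residue n j) \<le> real p powi (n - 1)}) {..<p}"
proof -
  have False if ij: "i < p" "j < p" "i \<noteq> j" and x: "x \<in> carrier (Qp p)"
      "pabs p (x \<ominus>\<^bsub>Qp p\<^esub> residue n i) \<le> real p powi (n - 1)"
      "pabs p (x \<ominus>\<^bsub>Qp p\<^esub> residue n j) \<le> real p powi (n - 1)" for i j x
  proof -
    have "\<not> int p dvd int i - int j"
      using ij by (simp flip: mod_eq_dvd_iff)
    from rat_pabs_of_int_eq_1[OF p this]
    have "pabs p (residue n i \<ominus>\<^bsub>Qp p\<^esub> residue n j) = real p powi n"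
      by (simp only: pabs_residue_diff mult_1)
    moreover have "real p powi (n - 1) < real p powi n"
      using p_gt_1 by (simp add: powi_eq_powr)
    ultimately show False
      using pabs_ultrametric[OF p residue_carrier x(1) residue_carrier, of n i n j] x
      by (simp add: pabs_minus_swap[OF p residue_carrier x(1)])
  qed
  then show ?thesis by (auto simp: disjoint_family_on_def)
qed

text \<open>B^n is the disjoint union of p translates of B^(n-1), which have equal measure by
  invariance. Together with the measure of the unit ball this recursion determines the measure of
  every ball, upwards and downwards.\<close>

lemma emeasure_pball_step: "emeasure M (pball p n) = ennreal (real p) * emeasure M (pball p (n - 1))"
proof -
  have "emeasure M (pball p n) = (\<Sum>j<p. emeasure M
      {x \<in> carrier (Qp p). pabs p (x \<ominus>\<^bsub>Qp p\<^esub> residue n j) \<le> real p powi (n - 1)})"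
    unfolding pball_partition[of n]
    using cball_sets[OF residue_carrier] disjoint_residue_balls
    by (intro sum_emeasure[symmetric]) auto
  then show ?thesis by (simp add: emeasure_cball[OF residue_carrier] ennreal_of_nat_eq_real_of_nat)
qed

lemma emeasure_pball: "emeasure M (pball p n) = ennreal (real p powi n)"
proof (induction n rule: int_induct[of _ 0])
  case base
  show ?case using haar by (simp add: is_haar_Qp_def pball_def)
next
  case (step1 i)
  then show ?case using emeasure_pball_step[of "i + 1"] p_gt_1
    by (simp add: power_int_add flip: ennreal_mult)
next
  case (step2 i)
  \<comment> \<open>The downward step divides the recursion by p; in \<open>ennreal\<close> this is
    done by multiplying both sides by 1/p.\<close>
  have "ennreal (inverse (real p)) * (ennreal (real p) * emeasure M (pball p (i - 1)))
      = ennreal (inverse (real p)) * ennreal (real p powi i)"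
    using step2 emeasure_pball_step[of i] by simp
  then show ?case using p_gt_1
    by (simp add: power_int_diff field_simps flip: ennreal_mult mult.assoc)
qed

lemma measure_pball: "measure M (pball p n) = real p powi n"
  by (simp add: measure_def emeasure_pball)

section \<open>The punctured line, its spheres and its compact subsets\<close>

lemma sets_star: "sets (star_measure p M) = {A \<in> sets M. A \<subseteq> Qp_star p}"
  using openin_sets[OF openin_Qp_star[OF p]] by (auto simp: star_measure_def sets_restrict_space_iff space_haar)
   (auto simp: sets_restrict_space)

lemma space_star: "space (star_measure p M) = Qp_star p"
  by (auto simp: star_measure_def space_restrict_space space_haar)

lemma emeasure_star: "A \<in> sets (star_measure p M) \<Longrightarrow> emeasure (star_measure p M) A = emeasure M A"
  using openin_sets[OF openin_Qp_star[OF p]] sets.Int[OF _ sets.top, of "Qp_star p" M]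
  unfolding star_measure_def
  by (subst emeasure_restrict_space) (auto simp: sets_star[unfolded star_measure_def])

lemma plog_sphere: "{x \<in> Qp_star p. plog p x = j} = pball p j - pball p (j - 1)"
proof -
  have "pball p j - pball p (j - 1) \<subseteq> Qp_star p"
    using pabs_eq_0_iff[OF p Qp.zero_closed] p_gt_1 by (auto simp: pball_def)
  moreover have "plog p x = j \<longleftrightarrow> x \<in> pball p j - pball p (j - 1)" if "x \<in> Qp_star p" for x
    unfolding Diff_iff pball_iff_plog[OF p that] by linarith
  ultimately show ?thesis by blast
qed

lemma plog_sphere_sets: "{x \<in> Qp_star p. plog p x = j} \<in> sets (star_measure p M)"
  by (subst sets_star) (use pball_sets plog_sphere in auto)

lemma emeasure_plog_sphere:
  "emeasure (star_measure p M) {x \<in> Qp_star p. plog p x = j} = ennreal ((1 - 1 / real p) * real p powi j)"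
proof -
  have "real p powi (j - 1) \<le> real p powi j" using p_gt_1 by (simp add: powi_le_iff)
  then have "pball p (j - 1) \<subseteq> pball p j" by (auto simp: pball_def)
  then have "emeasure M (pball p j - pball p (j - 1)) = ennreal (real p powi j) - ennreal (real p powi (j - 1))"
    by (subst emeasure_Diff) (auto simp: pball_sets emeasure_pball)
  also have "\<dots> = ennreal ((1 - 1 / real p) * real p powi j)"
    using p_gt_1 by (subst ennreal_minus) (auto simp: power_int_diff algebra_simps)
  finally show ?thesis unfolding emeasure_star[OF plog_sphere_sets] unfolding plog_sphere .
qed

lemma measurable_plog: "plog p \<in> measurable (star_measure p M) (count_space UNIV)"
  using plog_sphere_sets
  by (subst measurable_count_space_eq2_countable) (auto simp: space_star vimage_def Int_def conj_commute)

text \<open>The open ball of radius |x| around x stays on the sphere of x, by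
  \<open>pabs_eqI\<close>. The spheres thus form an open cover of the punctured line by disjoint
  sets.\<close>

lemma openin_plog_sphere: "openin (subtopology (ptop p) (Qp_star p)) {x \<in> Qp_star p. plog p x = j}"
proof -
  interpret Metric_space "carrier (Qp p)" "pdist p" by (rule Metric_space_Qp[OF p])
  have "mball x (pabs p x) \<subseteq> {x \<in> Qp_star p. plog p x = j}"
    if x: "x \<in> Qp_star p" "plog p x = j" for x
  proof
    fix y assume "y \<in> mball x (pabs p x)"
    then have y: "y \<in> carrier (Qp p)" and "pabs p (x \<ominus>\<^bsub>Qp p\<^esub> y) < pabs p x"
      using x by (auto simp: pdist_def split: if_splits)
    then have "pabs p x = pabs p y" using pabs_eqI[OF p _ y] x by simp
    moreover have "0 < pabs p x" using x p_gt_1 by (simp add: pabs_eq_plog[OF p])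
    ultimately show "y \<in> {x \<in> Qp_star p. plog p x = j}"
      using x y pabs_eq_0_iff[OF p Qp.zero_closed] by (auto simp: plog_def)
  qed
  then have "openin (ptop p) {x \<in> Qp_star p. plog p x = j}"
    unfolding ptop_def openin_mtopology
  proof (intro conjI allI impI)
    fix x assume x: "x \<in> {x \<in> Qp_star p. plog p x = j}"
    then have "0 < pabs p x" using p_gt_1 by (simp add: pabs_eq_plog[OF p])
    then show "\<exists>r>0. mball x r \<subseteq> {x \<in> Qp_star p. plog p x = j}"
      using \<open>\<And>x. x \<in> Qp_star p \<Longrightarrow> plog p x = j \<Longrightarrow> mball x (pabs p x) \<subseteq> {x \<in> Qp_star p. plog p x = j}\<close>[of x] x
      by blast
  qed auto
  then show ?thesis by (subst openin_open_subtopology[OF openin_Qp_star[OF p]]) auto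
qed

text \<open>Compact sets are closed in the Hausdorff space \<open>ptop p\<close>, hence Borel; a
  finite subcover of the cover by spheres bounds the number of spheres that are met.\<close>

lemma compactin_star:
  assumes E: "compactin (subtopology (ptop p) (Qp_star p)) E"
  shows "E \<in> sets (star_measure p M)" and "finite (plog p ` E)"
proof -
  have top: "topspace (subtopology (ptop p) (Qp_star p)) = Qp_star p"
    by (auto simp: topspace_ptop[OF p])
  have sub: "E \<subseteq> Qp_star p" using compactin_subset_topspace[OF E] top by simp
  have "compactin (ptop p) E" using E by (simp add: compactin_subtopology)
  then have "closedin (ptop p) E" by (rule compactin_imp_closedin[OF Hausdorff_ptop[OF p]])
  then have "openin (ptop p) (carrier (Qp p) - E)" by (simp add: closedin_def topspace_ptop[OF p])
  then have "space M - (carrier (Qp p) - E) \<in> sets M" by (intro sets.compl_sets openin_sets)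
  moreover have "space M - (carrier (Qp p) - E) = E" using sub by (auto simp: space_haar)
  ultimately show "E \<in> sets (star_measure p M)" using sub by (simp add: sets_star)
  have "\<forall>U\<in>range (\<lambda>j. {x \<in> Qp_star p. plog p x = j}). openin (subtopology (ptop p) (Qp_star p)) U"
    using openin_plog_sphere by auto
  moreover have "E \<subseteq> \<Union>(range (\<lambda>j. {x \<in> Qp_star p. plog p x = j}))" using sub by auto
  ultimately obtain F where F: "finite F" "F \<subseteq> range (\<lambda>j. {x \<in> Qp_star p. plog p x = j})" "E \<subseteq> \<Union>F"
    using E unfolding compactin_def by meson
  obtain J where "finite J" "F = (\<lambda>j. {x \<in> Qp_star p. plog p x = j}) ` J"
    using finite_subset_image[OF F(1,2)] by blast
  then have "plog p ` E \<subseteq> J" using F(3) by auto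
  then show "finite (plog p ` E)" using \<open>finite J\<close> by (rule finite_subset)
qed

end

section \<open>Averaging over spheres\<close>

text \<open>The left-hand side is the tangent to the convex function s^r at s = 1. It comes from
  Young's inequality with second factor 1 and conjugate exponent r/(r - 1).\<close>

lemma powr_ge_tangent:
  fixes r s :: real
  assumes "1 < r" "0 \<le> s" shows "r * s - (r - 1) \<le> s powr r"
proof -
  have "s * 1 \<le> s powr r / r + 1 powr (r / (r - 1)) / (r / (r - 1))"
    by (rule Youngs_inequality) (use assms in \<open>auto simp: field_simps\<close>)
  then have "s \<le> (s powr r + (r - 1)) / r" by (simp add: add_divide_distrib)
  then show ?thesis using assms by (simp add: pos_le_divide_eq mult_ac)
qed

text \<open>On a set of finite measure the pointwise bound |h| <= 1 + |h|^r gives an integrable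
  majorant.\<close>

lemma set_integrable_in_Lr:
  assumes h: "in_Lr r N h" and r: "1 < r" and S: "S \<in> sets N" "emeasure N S < \<infinity>"
  shows "set_integrable N S h"
  unfolding set_integrable_def
proof (rule Bochner_Integration.integrable_bound)
  show "integrable N (\<lambda>x. indicator S x + cmod (h x) powr r :: real)"
    using h S by (auto simp: in_Lr_def)
  show "(\<lambda>x. indicator S x *\<^sub>R h x) \<in> borel_measurable N"
    using h S by (auto simp: in_Lr_def)
  have "cmod (h x) \<le> 1 + cmod (h x) powr r" for x
  proof (cases "cmod (h x) \<le> 1")
    case False
    then have "cmod (h x) powr 1 \<le> cmod (h x) powr r" using r by (intro powr_mono) auto
    then show ?thesis using False by simp
  qed (simp add: add_increasing2)
  then show "AE x in N. norm (indicator S x *\<^sub>R h x) \<le> norm (indicator S x + cmod (h x) powr r :: real)"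
    by (auto simp: indicator_def)
qed

text \<open>Hoelder's inequality against the constant 1, raised to the power r so that no conjugate
  exponent appears. It results from integrating the tangent inequality for |h| / t over S with the
  best choice of t.\<close>

lemma set_integral_powr_le:
  assumes h: "in_Lr r N h" and r: "1 < r" and S: "S \<in> sets N"
    and \<mu>: "emeasure N S = ennreal \<mu>" "0 < \<mu>"
  shows "(LINT x:S|N. cmod (h x)) powr r \<le> \<mu> powr (r - 1) * (LINT x:S|N. cmod (h x) powr r)"
proof -
  define w where "w = (LINT x:S|N. cmod (h x))"
  define I where "I = (LINT x:S|N. cmod (h x) powr r)"
  have int_r: "set_integrable N S (\<lambda>x. cmod (h x) powr r)"
    using h S unfolding in_Lr_def set_integrable_def by (intro integrable_mult_indicator) auto
  have int_1: "set_integrable N S (\<lambda>x. cmod (h x))"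
    using set_integrable_norm[OF set_integrable_in_Lr[OF h r S]] \<mu> by simp
  have "0 \<le> w" unfolding w_def set_lebesgue_integral_def by (intro integral_nonneg_AE) auto
  have "0 \<le> I" unfolding I_def set_lebesgue_integral_def by (intro integral_nonneg_AE) auto
  show ?thesis
  proof (cases "w = 0")
    case True
    then show ?thesis using \<open>0 \<le> I\<close> by (simp add: w_def I_def)
  next
    case False
    \<comment> \<open>The mean of |h| over S. For this t the integrated tangent line r w / t - (r -
      1) \<mu> equals \<mu>.\<close>
    define t where "t = w / \<mu>"
    have t: "0 < t" using False \<open>0 \<le> w\<close> \<mu> by (simp add: t_def)
    have one: "set_integrable N S (\<lambda>x. 1 :: real)" "(LINT x:S|N. (1::real)) = \<mu>"
      using S \<mu> by (auto simp: set_integrable_def set_lebesgue_integral_def measure_def)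
    have "r / t * w - (r - 1) * \<mu> = (LINT x:S|N. r / t * cmod (h x) - (r - 1) * 1)"
      by (simp only: set_integral_diff(2)[OF set_integrable_mult_right[OF int_1]
          set_integrable_mult_right[OF one(1)]] set_integral_mult_right one(2) w_def)
    also have "\<dots> \<le> (LINT x:S|N. cmod (h x) powr r / t powr r)"
    proof (rule set_integral_mono)
      show "set_integrable N S (\<lambda>x. r / t * cmod (h x) - (r - 1) * 1)"
        by (intro set_integral_diff set_integrable_mult_right int_1 one)
      show "set_integrable N S (\<lambda>x. cmod (h x) powr r / t powr r)"
        by (intro set_integrable_divide int_r)
      show "r / t * cmod (h x) - (r - 1) * 1 \<le> cmod (h x) powr r / t powr r" for x
        using powr_ge_tangent[OF r, of "cmod (h x) / t"] t by (simp add: powr_divide)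
    qed
    also have "\<dots> = I / t powr r" by (simp add: I_def)
    finally have "\<mu> \<le> I / t powr r"
      using \<mu> False by (simp add: t_def algebra_simps)
    then have "\<mu> * t powr r \<le> I" using t by (simp add: field_simps)
    moreover have "w powr r = \<mu> powr (r - 1) * (\<mu> * t powr r)"
    proof -
      have "w = \<mu> * t" using \<mu> by (simp add: t_def)
      then have "w powr r = \<mu> powr r * t powr r" using \<mu> t by (simp add: powr_mult)
      also have "\<mu> powr r = \<mu> powr (r - 1) * \<mu>"
        using \<mu> powr_add[of \<mu> "r - 1" 1] by simp
      finally show ?thesis by simp
    qed
    ultimately show ?thesis unfolding w_def[symmetric] I_def[symmetric]
      by (simp add: mult_left_mono)
  qed
qed

lemma in_Lr_boundI:
  assumes f: "f \<in> borel_measurable N" and r: "1 < r" and c: "0 \<le> c"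
    and le: "(\<integral>\<^sup>+x. ennreal (cmod (f x) powr r) \<partial>N) \<le> ennreal (c powr r)"
  shows "in_Lr r N f" and "Lr_norm r N f \<le> c"
proof -
  show int: "in_Lr r N f" unfolding in_Lr_def
    using f le by (intro conjI integrableI_bounded) (auto intro: le_less_trans)
  have "ennreal (\<integral>x. cmod (f x) powr r \<partial>N) = (\<integral>\<^sup>+x. ennreal (cmod (f x) powr r) \<partial>N)"
    using int by (intro nn_integral_eq_integral[symmetric]) (auto simp: in_Lr_def)
  then have "(\<integral>x. cmod (f x) powr r \<partial>N) \<le> c powr r"
    using le by (metis ennreal_le_iff powr_ge_zero)
  then have "Lr_norm r N f \<le> (c powr r) powr (1 / r)"
    unfolding Lr_norm_def using r by (intro powr_mono2) (auto intro!: integral_nonneg_AE)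
  then show "Lr_norm r N f \<le> c" using r c by (simp add: powr_powr)
qed

lemma Lr_norm_powr:
  assumes "0 < r" shows "Lr_norm r N f powr r = (\<integral>x. cmod (f x) powr r \<partial>N)"
  using assms by (simp add: Lr_norm_def powr_powr integral_nonneg_AE)

text \<open>Summable L^1 norms force absolute convergence almost everywhere, so the limit
  \<open>h\<close> has to be identified only at points of absolute convergence. The conditional
  hypothesis is made for the double series below, which may be rearranged at exactly those
  points.\<close>

lemma integral_series:
  fixes g :: "nat \<Rightarrow> 'a \<Rightarrow> complex"
  assumes int: "\<And>n. integrable N (g n)" and sm: "summable (\<lambda>n. \<integral>x. cmod (g n x) \<partial>N)"
    and lim: "AE x in N. summable (\<lambda>n. cmod (g n x)) \<longrightarrow> (\<lambda>n. g n x) sums h x"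
    and h: "h \<in> borel_measurable N"
  shows "integrable N h" and "(\<lambda>n. \<integral>x. g n x \<partial>N) sums (\<integral>x. h x \<partial>N)"
proof -
  have "(\<integral>\<^sup>+x. (\<Sum>n. ennreal (cmod (g n x))) \<partial>N) = (\<Sum>n. \<integral>\<^sup>+x. ennreal (cmod (g n x)) \<partial>N)"
    using int by (intro nn_integral_suminf) auto
  also have "\<dots> = (\<Sum>n. ennreal (\<integral>x. cmod (g n x) \<partial>N))"
    using int by (intro suminf_cong nn_integral_eq_integral) auto
  also have "\<dots> \<noteq> \<infinity>" using sm by (simp add: ennreal_suminf_neq_top)
  finally have "AE x in N. (\<Sum>n. ennreal (cmod (g n x))) \<noteq> \<infinity>"
    using int by (intro nn_integral_PInf_AE) auto
  then have AE_sm: "AE x in N. summable (\<lambda>n. cmod (g n x))"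
    by eventually_elim (auto intro: summable_suminf_not_top)
  have AE_eq: "AE x in N. (\<Sum>n. g n x) = h x"
    using AE_sm lim by eventually_elim (auto simp: sums_iff)
  note S = integrable_suminf[OF int AE_sm sm] sums_integral[OF int AE_sm sm]
  show "integrable N h" using S(1) AE_eq h by (subst integrable_cong_AE[where g = "\<lambda>x. \<Sum>n. g n x"]) auto
  have "(\<integral>x. (\<Sum>n. g n x) \<partial>N) = (\<integral>x. h x \<partial>N)"
    using S(1) AE_eq h by (intro integral_cong_AE) auto
  then show "(\<lambda>n. \<integral>x. g n x \<partial>N) sums (\<integral>x. h x \<partial>N)" using S(2) by simp
qed

text \<open>Block decompositions are indexed by \<open>nat\<close>, but the image of one is
  naturally indexed by a block number and an integer radius shift; this bijection renumbers
  it.\<close>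

definition pair_enum :: "nat \<Rightarrow> nat \<times> int" where
  "pair_enum e = map_prod id int_decode (prod_decode e)"

lemma bij_pair_enum: "bij pair_enum"
proof -
  have "bij (map_prod id int_decode :: nat \<times> nat \<Rightarrow> nat \<times> int)"
    using bij_betw_map_prod[OF bij_id bij_int_decode] by simp
  then show ?thesis
    using bij_comp[OF bij_prod_decode] by (simp add: pair_enum_def[abs_def] comp_def)
qed

lemma has_sum_pair_enum: "((\<lambda>e. f (pair_enum e)) has_sum s) UNIV \<longleftrightarrow> (f has_sum s) UNIV"
  by (rule has_sum_reindex_bij_betw[OF bij_pair_enum])

text \<open>All terms are nonnegative, so summing the rows and then the row totals is legitimate. It
  serves both as the majorant for the interchange and as the exact sum of the new
  coefficients.\<close>

lemma sums_pair_enum_product: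
  fixes f :: "nat \<Rightarrow> real" and g :: "int \<Rightarrow> real"
  assumes f: "summable f" "\<And>k. 0 \<le> f k" and g: "g summable_on UNIV" "\<And>i. 0 \<le> g i"
  shows "(\<lambda>e. f (fst (pair_enum e)) * g (snd (pair_enum e))) sums ((\<Sum>k. f k) * (\<Sum>\<^sub>\<infinity>i. g i))"
proof -
  have row: "((\<lambda>i. f (fst (k, i)) * g (snd (k, i))) has_sum f k * (\<Sum>\<^sub>\<infinity>i. g i)) UNIV" for k
    using has_sum_cmult_right[OF has_sum_infsum[OF g(1)]] by simp
  have col: "((\<lambda>k. f k * (\<Sum>\<^sub>\<infinity>i. g i)) has_sum (\<Sum>k. f k) * (\<Sum>\<^sub>\<infinity>i. g i)) UNIV"
    by (intro has_sum_cmult_left sums_nonneg_imp_has_sum summable_sums f)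
  have "(\<lambda>z. f (fst z) * g (snd z)) summable_on UNIV \<times> UNIV"
    by (rule summable_on_SigmaI[OF row has_sum_imp_summable[OF col]]) (use f g in auto)
  then have "((\<lambda>z. f (fst z) * g (snd z)) has_sum (\<Sum>k. f k) * (\<Sum>\<^sub>\<infinity>i. g i)) (UNIV \<times> UNIV)"
    by (rule has_sum_SigmaI[OF row col])
  then show ?thesis
    by (intro has_sum_imp_sums) (simp add: has_sum_pair_enum[of "\<lambda>z. f (fst z) * g (snd z)"])
qed

section \<open>Blocks on a space divided into spheres\<close>

text \<open>For the punctured \<open>p\<close>-adic line, \<open>v x = j\<close> means that \<open>x\<close> has absolute value \<open>q\<^sup>j\<close>, with \<open>q = p\<close>.\<close>

locale spheres =
  fixes N :: "'a measure" and v :: "'a \<Rightarrow> int" and q r \<alpha> :: real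
  assumes q: "1 < q" and r: "1 < r" and \<alpha>: "0 < \<alpha>"
    and measurable_v [measurable]: "v \<in> measurable N (count_space UNIV)"
    and emeasure_sphere': "\<And>j. emeasure N {x \<in> space N. v x = j} = ennreal ((1 - 1 / q) * q powi j)"
begin

definition sphere where "sphere j = {x \<in> space N. v x = j}"

abbreviation \<beta> where "\<beta> \<equiv> 1 / r + \<alpha> - 1"

definition vol where "vol j = (1 - 1 / q) * q powr (of_int j)"

lemma emeasure_sphere: "emeasure N (sphere j) = ennreal (vol j)"
  using emeasure_sphere' q by (simp add: sphere_def vol_def powi_eq_powr)

lemma sphere_sets [measurable]: "sphere j \<in> sets N"
  unfolding sphere_def by measurable

lemma vol_pos: "0 < vol j" using q by (simp add: vol_def)

lemma measurable_of_v: "(\<lambda>x. G (v x) :: complex) \<in> borel_measurable N"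
  by (rule measurable_compose[OF measurable_v]) simp

text \<open>Each point lies on exactly one sphere, so the indicators add up to 1; the interchange is
  Tonelli's theorem with counting measure on the integers.\<close>

lemma nn_integral_spheres:
  fixes f :: "'a \<Rightarrow> ennreal"
  assumes [measurable]: "f \<in> borel_measurable N"
  shows "(\<integral>\<^sup>+x. f x \<partial>N) = (\<integral>\<^sup>+j. (\<integral>\<^sup>+x. f x * indicator (sphere j) x \<partial>N) \<partial>count_space UNIV)"
proof -
  have "f x = (\<integral>\<^sup>+j. f x * indicator (sphere j) x \<partial>count_space UNIV)" if x: "x \<in> space N" for x
  proof -
    have "(\<integral>\<^sup>+j. f x * indicator (sphere j) x \<partial>count_space UNIV) = (\<integral>\<^sup>+j. f x * indicator {v x} j \<partial>count_space UNIV)"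
      using x by (intro nn_integral_cong) (auto simp: sphere_def indicator_def)
    then show ?thesis by (simp add: nn_integral_cmult)
  qed
  then have "(\<integral>\<^sup>+x. f x \<partial>N) = (\<integral>\<^sup>+x. (\<integral>\<^sup>+j. f x * indicator (sphere j) x \<partial>count_space UNIV) \<partial>N)"
    by (intro nn_integral_cong) auto
  then show ?thesis by (subst (asm) nn_integral_count_space_nn_integral) auto
qed

text \<open>A central block with the index of its ball kept visible:
  \<open>q powr (- \<alpha> * of_int n)\<close> is |B^n|^(-\<alpha>). The index has to be tracked
  because averaging shifts it.\<close>

definition block :: "('a \<Rightarrow> complex) \<Rightarrow> int \<Rightarrow> bool" where
  "block a n \<longleftrightarrow> (\<forall>x\<in>space N. a x \<noteq> 0 \<longrightarrow> v x \<le> n) \<and> in_Lr r N a \<and>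
     Lr_norm r N a \<le> q powr (- \<alpha> * of_int n)"

lemma block_integral_powr_le:
  assumes "block a n"
  shows "(\<integral>x. cmod (a x) powr r \<partial>N) \<le> q powr (- \<alpha> * r * of_int n)"
proof -
  have "Lr_norm r N a powr r \<le> (q powr (- \<alpha> * of_int n)) powr r"
    using assms r by (intro powr_mono2) (auto simp: block_def Lr_norm_def)
  then show ?thesis using r by (simp add: Lr_norm_powr powr_powr mult_ac)
qed

lemma set_integrable_sphere: "block a n \<Longrightarrow> set_integrable N (sphere j) a"
  using set_integrable_in_Lr[of r N a "sphere j"] r by (simp add: block_def emeasure_sphere)

text \<open>Spheres outside the ball contribute 0. For j <= n the block bound weakens to
  q^(-\<alpha> j), which removes n, and Hoelder's inequality supplies q^(j(1 - 1/r)). Being uniform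
  in the block, the estimate can dominate a whole series of blocks.\<close>

lemma block_sphere_integral_le:
  assumes a: "block a n"
  shows "(LINT x:sphere j|N. cmod (a x)) \<le> q powr (- of_int j * \<beta>)"
proof (cases "j \<le> n")
  case False
  then have "indicator (sphere j) x *\<^sub>R cmod (a x) = 0" if "x \<in> space N" for x
    using a that by (auto simp: block_def sphere_def indicator_def)
  then have "(LINT x:sphere j|N. cmod (a x)) = 0"
    unfolding set_lebesgue_integral_def
    using Bochner_Integration.integral_cong[OF refl, of N _ "\<lambda>x. 0::real"] by simp
  then show ?thesis by simp
next
  case True
  let ?w = "LINT x:sphere j|N. cmod (a x)"
  have a': "in_Lr r N a" using a by (simp add: block_def)
  have w: "0 \<le> ?w" unfolding set_lebesgue_integral_def by (intro integral_nonneg_AE) auto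
  have "(LINT x:sphere j|N. cmod (a x) powr r) \<le> (\<integral>x. cmod (a x) powr r \<partial>N)"
    unfolding set_lebesgue_integral_def using a'
    by (intro integral_mono integrable_mult_indicator) (auto simp: in_Lr_def indicator_def)
  also have "\<dots> \<le> q powr (- \<alpha> * r * of_int n)" by (rule block_integral_powr_le[OF a])
  also have "\<dots> \<le> q powr (- \<alpha> * r * of_int j)"
    using q True \<alpha> r by (intro powr_mono) (auto simp: mult_left_mono_neg)
  finally have I: "(LINT x:sphere j|N. cmod (a x) powr r) \<le> q powr (- \<alpha> * r * of_int j)" .
  \<comment> \<open>The factor 1 - 1/q is dropped here, since this estimate only provides a
    majorant; \<open>block_average\<close> keeps it.\<close>
  have "vol j \<le> q powr of_int j" using q by (simp add: vol_def mult_left_le_one_le)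
  then have "vol j powr (r - 1) \<le> (q powr of_int j) powr (r - 1)"
    using vol_pos r by (intro powr_mono2) (auto simp: less_imp_le)
  then have V: "vol j powr (r - 1) \<le> q powr (of_int j * (r - 1))" by (simp add: powr_powr)
  have "?w powr r \<le> vol j powr (r - 1) * (LINT x:sphere j|N. cmod (a x) powr r)"
    by (rule set_integral_powr_le[OF a' r sphere_sets emeasure_sphere vol_pos])
  also have "\<dots> \<le> q powr (of_int j * (r - 1)) * q powr (- \<alpha> * r * of_int j)"
    using V I by (intro mult_mono) (auto simp: set_lebesgue_integral_def intro!: integral_nonneg_AE)
  also have "\<dots> = (q powr (- of_int j * \<beta>)) powr r"
    unfolding powr_powr powr_add[symmetric] using r
    by (intro arg_cong[where f = "(powr) q"]) (simp add: field_simps)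
  finally have le: "?w powr r \<le> (q powr (- of_int j * \<beta>)) powr r" .
  show ?thesis
  proof (rule ccontr)
    assume "\<not> ?thesis"
    then have "(q powr (- of_int j * \<beta>)) powr r < ?w powr r"
      using r by (intro powr_less_mono2) auto
    then show False using le by simp
  qed
qed

text \<open>Up to the constant (1 - 1/q) q^i this is the mean of a over the sphere of radius q^i
  |x|. The normalisation by |x| alone is the one that a kernel of degree -1 produces.\<close>

definition average :: "int \<Rightarrow> ('a \<Rightarrow> complex) \<Rightarrow> 'a \<Rightarrow> complex" where
  "average i a x = of_real (q powi (- v x)) * (LINT y:sphere (v x + i)|N. a y)"

text \<open>Hoelder's inequality on the sphere of y gives (1 - 1/q)^(1 - 1/r), and the measure of
  the sphere of x adds (1 - 1/q)^(1/r) to the L^r norm; their product is the 1 - 1/q that the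
  normalising factor divides out. The estimate is made sphere by sphere and then summed.\<close>

lemma block_average:
  assumes a: "block a n"
  shows "block (\<lambda>x. of_real (q powr (of_int i * \<beta>) / (1 - 1 / q)) * average i a x) (n - i)"
proof -
  \<comment> \<open>The function depends on x only through m = v x, which gives measurability and
    makes it constant on each sphere.\<close>
  define G where "G m = of_real (q powr (of_int i * \<beta>) / (1 - 1 / q)) *
     (of_real (q powi (- m)) * (LINT y:sphere (m + i)|N. a y))" for m
  have G: "(\<lambda>x. of_real (q powr (of_int i * \<beta>) / (1 - 1 / q)) * average i a x) = (\<lambda>x. G (v x))"
    by (simp add: G_def average_def)
  have [measurable]: "(\<lambda>x. G (v x)) \<in> borel_measurable N" by (rule measurable_of_v)
  have a': "in_Lr r N a" using a by (simp add: block_def)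
  have [measurable]: "a \<in> borel_measurable N" using a' by (simp add: in_Lr_def)
  have supp: "v x \<le> n - i" if x: "x \<in> space N" "G (v x) \<noteq> 0" for x
  proof (rule ccontr)
    assume "\<not> v x \<le> n - i"
    then have "indicator (sphere (v x + i)) y *\<^sub>R a y = 0" if "y \<in> space N" for y
      using a that by (auto simp: block_def sphere_def indicator_def)
    then have "(LINT y:sphere (v x + i)|N. a y) = 0"
      unfolding set_lebesgue_integral_def
      using Bochner_Integration.integral_cong[OF refl, of N _ "\<lambda>x. 0::complex"] by simp
    then show False using x by (simp add: G_def)
  qed
  \<comment> \<open>Sphere m of the result is controlled by sphere m + i of \<open>a\<close> alone.
    The factor q^(i \<alpha> r) is the r-th power of the ratio of the norm bounds allowed for
    B^(n-i) and B^n.\<close>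
  have step: "(\<integral>\<^sup>+x. ennreal (cmod (G (v x)) powr r) * indicator (sphere m) x \<partial>N)
      \<le> ennreal (q powr (of_int i * \<alpha> * r)) *
        (\<integral>\<^sup>+x. ennreal (cmod (a x) powr r) * indicator (sphere (m + i)) x \<partial>N)" for m
  proof -
    let ?I = "LINT y:sphere (m + i)|N. cmod (a y) powr r"
    have "cmod (LINT y:sphere (m + i)|N. a y) \<le> (LINT y:sphere (m + i)|N. cmod (a y))"
      unfolding set_lebesgue_integral_def
      by (rule order.trans[OF integral_norm_bound]) simp
    then have "cmod (LINT y:sphere (m + i)|N. a y) powr r \<le> (LINT y:sphere (m + i)|N. cmod (a y)) powr r"
      using r by (intro powr_mono2) auto
    also have "\<dots> \<le> vol (m + i) powr (r - 1) * ?I"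
      by (rule set_integral_powr_le[OF a' r sphere_sets emeasure_sphere vol_pos])
    finally have H: "cmod (LINT y:sphere (m + i)|N. a y) powr r \<le> vol (m + i) powr (r - 1) * ?I" .
    have D: "0 < 1 - 1 / q" using q by simp
    have "cmod (G m) = q powr (of_int i * \<beta>) / (1 - 1 / q) * q powr (- of_int m) *
        cmod (LINT y:sphere (m + i)|N. a y)"
      using q D by (simp add: G_def norm_mult powi_eq_powr del: of_real_divide of_real_diff)
    then have "cmod (G m) powr r = (q powr (of_int i * \<beta>) / (1 - 1 / q) * q powr (- of_int m)) powr r *
        cmod (LINT y:sphere (m + i)|N. a y) powr r"
      using D by (simp only: powr_mult)
    also have "\<dots> \<le> (q powr (of_int i * \<beta>) / (1 - 1 / q) * q powr (- of_int m)) powr r *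
        (vol (m + i) powr (r - 1) * ?I)"
      by (intro mult_left_mono H) auto
    finally have "cmod (G m) powr r * vol m \<le>
       (q powr (of_int i * \<beta>) / (1 - 1 / q) * q powr (- of_int m)) powr r *
        (vol (m + i) powr (r - 1) * ?I) * vol m"
      using vol_pos[of m] by (intro mult_right_mono) auto
    also have "\<dots> = q powr (of_int i * \<alpha> * r) * ?I"
    proof -
      define D where "D = 1 - 1 / q"
      have D: "0 < D" using q by (simp add: D_def)
      have "(q powr (of_int i * \<beta>) / D * q powr (- of_int m)) powr r
          = q powr (of_int i * \<beta> * r) * D powr (- r) * q powr (- of_int m * r)"
        using D q by (simp add: powr_mult powr_divide powr_powr powr_minus field_simps)
      moreover have "vol (m + i) powr (r - 1) = D powr (r - 1) * q powr (of_int (m + i) * (r - 1))"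
        using D q by (simp add: vol_def powr_mult powr_powr flip: D_def)
      moreover have "vol m = D powr 1 * q powr of_int m"
        using D by (simp add: vol_def flip: D_def)
      moreover have "q powr (of_int i * \<beta> * r) * D powr (- r) * q powr (- of_int m * r) *
          (D powr (r - 1) * q powr (of_int (m + i) * (r - 1)) * ?I) * (D powr 1 * q powr of_int m)
         = (D powr (- r) * D powr (r - 1) * D powr 1) *
           (q powr (of_int i * \<beta> * r) * q powr (- of_int m * r) * q powr (of_int (m + i) * (r - 1)) * q powr of_int m) * ?I"
        by (simp only: mult_ac)
      moreover have "D powr (- r) * D powr (r - 1) * D powr 1 = 1"
        using D by (simp flip: powr_add)
      \<comment> \<open>The terms - m r + m (r - 1) + m cancel, and i \<beta> r + i (r - 1) = i
        \<alpha> r because \<beta> r = 1 + \<alpha> r - r.\<close>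
      moreover have "q powr (of_int i * \<beta> * r) * q powr (- of_int m * r) * q powr (of_int (m + i) * (r - 1)) * q powr of_int m
         = q powr (of_int i * \<alpha> * r)"
        unfolding powr_add[symmetric] using r by (intro arg_cong[where f = "(powr) q"]) (simp add: field_simps)
      ultimately show ?thesis unfolding D_def[symmetric] by (simp only: mult_1)
    qed
    finally have fin: "cmod (G m) powr r * vol m \<le> q powr (of_int i * \<alpha> * r) * ?I" .
    have "(\<integral>\<^sup>+x. ennreal (cmod (G (v x)) powr r) * indicator (sphere m) x \<partial>N)
        = (\<integral>\<^sup>+x. ennreal (cmod (G m) powr r) * indicator (sphere m) x \<partial>N)"
      by (intro nn_integral_cong) (auto simp: sphere_def indicator_def)
    also have "\<dots> = ennreal (cmod (G m) powr r * vol m)"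
      using vol_pos[of m] by (simp add: nn_integral_cmult_indicator emeasure_sphere ennreal_mult)
    also have "\<dots> \<le> ennreal (q powr (of_int i * \<alpha> * r) * ?I)" using fin by (rule ennreal_leI)
    also have "\<dots> = ennreal (q powr (of_int i * \<alpha> * r)) * ennreal ?I"
      by (intro ennreal_mult) (auto simp: set_lebesgue_integral_def intro!: integral_nonneg_AE)
    also have "ennreal ?I = (\<integral>\<^sup>+x. ennreal (indicator (sphere (m + i)) x *\<^sub>R cmod (a x) powr r) \<partial>N)"
      unfolding set_lebesgue_integral_def using a'
      by (intro nn_integral_eq_integral[symmetric] integrable_mult_indicator) (auto simp: in_Lr_def)
    also have "\<dots> = (\<integral>\<^sup>+x. ennreal (cmod (a x) powr r) * indicator (sphere (m + i)) x \<partial>N)"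
      by (intro nn_integral_cong) (auto simp: indicator_def)
    finally show ?thesis .
  qed
  have "(\<integral>\<^sup>+x. ennreal (cmod (G (v x)) powr r) \<partial>N)
      = (\<integral>\<^sup>+m. (\<integral>\<^sup>+x. ennreal (cmod (G (v x)) powr r) * indicator (sphere m) x \<partial>N) \<partial>count_space UNIV)"
    by (rule nn_integral_spheres) measurable
  also have "\<dots> \<le> (\<integral>\<^sup>+m. ennreal (q powr (of_int i * \<alpha> * r)) *
        (\<integral>\<^sup>+x. ennreal (cmod (a x) powr r) * indicator (sphere (m + i)) x \<partial>N) \<partial>count_space UNIV)"
    by (intro nn_integral_mono step)
  also have "\<dots> = ennreal (q powr (of_int i * \<alpha> * r)) *
      (\<integral>\<^sup>+m. (\<integral>\<^sup>+x. ennreal (cmod (a x) powr r) * indicator (sphere (m + i)) x \<partial>N) \<partial>count_space UNIV)"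
    by (rule nn_integral_cmult) simp
  also have "(\<integral>\<^sup>+m. (\<integral>\<^sup>+x. ennreal (cmod (a x) powr r) * indicator (sphere (m + i)) x \<partial>N) \<partial>count_space UNIV)
      = (\<integral>\<^sup>+m. (\<integral>\<^sup>+x. ennreal (cmod (a x) powr r) * indicator (sphere m) x \<partial>N) \<partial>count_space UNIV)"
    by (rule nn_integral_bij_count_space) (auto simp: bij_betw_def inj_on_def intro!: image_eqI[of _ _ "_ - i"])
  also have "\<dots> = (\<integral>\<^sup>+x. ennreal (cmod (a x) powr r) \<partial>N)"
    by (rule nn_integral_spheres[symmetric]) measurable
  also have "\<dots> = ennreal (\<integral>x. cmod (a x) powr r \<partial>N)"
    using a' by (intro nn_integral_eq_integral) (auto simp: in_Lr_def)
  also have "ennreal (q powr (of_int i * \<alpha> * r)) * \<dots> \<le>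
      ennreal (q powr (of_int i * \<alpha> * r)) * ennreal (q powr (- \<alpha> * r * of_int n))"
    by (intro mult_left_mono ennreal_leI block_integral_powr_le[OF a]) auto
  also have "\<dots> = ennreal ((q powr (- \<alpha> * of_int (n - i))) powr r)"
    by (simp add: powr_powr powr_add[symmetric] algebra_simps flip: ennreal_mult)
  finally have "(\<integral>\<^sup>+x. ennreal (cmod (G (v x)) powr r) \<partial>N) \<le>
      ennreal ((q powr (- \<alpha> * of_int (n - i))) powr r)" .
  then show ?thesis
    unfolding G block_def using supp r by (intro conjI in_Lr_boundI) auto
qed

section \<open>The image of one block decomposition; \<open>\<kappa> i\<close> stands for K(1,
  q^i)\<close>

context
  fixes \<kappa> :: "int \<Rightarrow> real" and c :: "nat \<Rightarrow> complex" and a :: "nat \<Rightarrow> 'a \<Rightarrow> complex"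
    and n :: "nat \<Rightarrow> int" and f :: "'a \<Rightarrow> complex"
  assumes \<kappa>_nonneg: "\<And>i. 0 \<le> \<kappa> i"
    and \<kappa>_summable: "(\<lambda>i. \<kappa> i * q powr (- (of_int i * \<beta>))) summable_on UNIV"
    and c_summable: "summable (\<lambda>k. cmod (c k))"
    and a_block: "\<And>k. block (a k) (n k)"
    and f_measurable: "f \<in> borel_measurable N"
    and f_sums: "AE x in N. (\<lambda>k. c k * a k x) sums f x"
begin

text \<open>The integrand is cut up by block k and sphere m + i, on which the kernel has the
  constant value q^(-m) \<kappa> i. The L^1 norms of the pieces are dominated by the terms of a
  product of two convergent series, for every m; taking m = v x gives the expansion at each point
  x.\<close>

lemma kernel_integral_sums:
  shows "integrable N (\<lambda>y. of_real (q powi (- m) * \<kappa> (v y - m)) * f y)" (is "integrable N ?h")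
    and "(\<lambda>e. c (fst (pair_enum e)) * of_real (q powi (- m) * \<kappa> (snd (pair_enum e))) *
              (LINT y:sphere (m + snd (pair_enum e))|N. a (fst (pair_enum e)) y))
         sums (\<integral>y. of_real (q powi (- m) * \<kappa> (v y - m)) * f y \<partial>N)"
proof -
  define g where "g z y = c (fst z) * of_real (q powi (- m) * \<kappa> (snd z)) *
     (indicator (sphere (m + snd z)) y *\<^sub>R a (fst z) y)" for z y
  have int: "integrable N (g z)" for z
    unfolding g_def using set_integrable_sphere[OF a_block]
    by (intro integrable_mult_right) (simp add: set_integrable_def)
  have norm_le: "(\<integral>y. cmod (g (k, i) y) \<partial>N) \<le>
     q powr (- of_int m * (1 + \<beta>)) * (cmod (c k) * (\<kappa> i * q powr (- (of_int i * \<beta>))))" for k i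
  proof -
    have "(\<integral>y. cmod (g (k, i) y) \<partial>N) = cmod (c k) * (q powi (- m) * \<kappa> i) * (LINT y:sphere (m + i)|N. cmod (a k y))"
    proof -
      have "cmod (g (k, i) y) = cmod (c k) * (q powi (- m) * \<kappa> i) * (indicator (sphere (m + i)) y *\<^sub>R cmod (a k y))" for y
        using \<kappa>_nonneg[of i] q by (simp add: g_def norm_mult del: of_real_power_int of_real_mult)
      then show ?thesis by (simp only: set_lebesgue_integral_def integral_mult_right_zero)
    qed
    also have "\<dots> \<le> cmod (c k) * (q powi (- m) * \<kappa> i) * q powr (- of_int (m + i) * \<beta>)"
      using \<kappa>_nonneg[of i] q by (intro mult_left_mono block_sphere_integral_le[OF a_block]) auto
    also have "\<dots> = (q powr (- of_int m) * q powr (- of_int (m + i) * \<beta>)) * (cmod (c k) * \<kappa> i)"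
      using q by (simp add: powi_eq_powr)
    also have "q powr (- of_int m) * q powr (- of_int (m + i) * \<beta>)
        = q powr (- of_int m * (1 + \<beta>)) * q powr (- (of_int i * \<beta>))"
      unfolding powr_add[symmetric] by (intro arg_cong[where f = "(powr) q"]) (simp add: algebra_simps)
    finally show ?thesis by (simp add: mult_ac)
  qed
  have "summable (\<lambda>e. cmod (c (fst (pair_enum e))) *
     (\<kappa> (snd (pair_enum e)) * q powr (- (of_int (snd (pair_enum e)) * \<beta>))))"
    using sums_pair_enum_product[OF c_summable _ \<kappa>_summable] \<kappa>_nonneg by (auto simp: sums_iff)
  from summable_mult[OF this, of "q powr (- of_int m * (1 + \<beta>))"]
  have sm: "summable (\<lambda>e. \<integral>y. cmod (g (pair_enum e) y) \<partial>N)"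
  proof (rule summable_comparison_test'[where N = 0])
    fix e
    show "norm (\<integral>y. cmod (g (pair_enum e) y) \<partial>N) \<le> q powr (- of_int m * (1 + \<beta>)) *
        (cmod (c (fst (pair_enum e))) * (\<kappa> (snd (pair_enum e)) * q powr (- (of_int (snd (pair_enum e)) * \<beta>))))"
      using norm_le[of "fst (pair_enum e)" "snd (pair_enum e)"]
      unfolding prod.collapse by (simp add: integral_nonneg_AE)
  qed
  have lim: "AE y in N. summable (\<lambda>e. cmod (g (pair_enum e) y)) \<longrightarrow> (\<lambda>e. g (pair_enum e) y) sums ?h y"
    using f_sums AE_space
  proof eventually_elim
    fix y assume fy: "(\<lambda>k. c k * a k y) sums f y" and y: "y \<in> space N"
    show "summable (\<lambda>e. cmod (g (pair_enum e) y)) \<longrightarrow> (\<lambda>e. g (pair_enum e) y) sums ?h y"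
    proof
      assume "summable (\<lambda>e. cmod (g (pair_enum e) y))"
      then obtain s where s: "((\<lambda>e. g (pair_enum e) y) has_sum s) UNIV"
        using norm_summable_imp_summable_on[of "\<lambda>e. g (pair_enum e) y"] by (auto simp: summable_on_def)
      then have "((\<lambda>z. g z y) has_sum s) UNIV"
        using has_sum_pair_enum[of "\<lambda>z. g z y"] by simp
      \<comment> \<open>At the point y only pairs with i = v y - m survive. The double series thus
        reduces to a series over k whose sum in the natural order is known from the decomposition of
        f.\<close>
      also have "((\<lambda>z. g z y) has_sum s) UNIV \<longleftrightarrow> ((\<lambda>z. g z y) has_sum s) (range (\<lambda>k. (k, v y - m)))"
        using y by (intro has_sum_cong_neutral) (auto simp: g_def sphere_def indicator_def)
      also have "\<dots> \<longleftrightarrow> ((\<lambda>k. g (k, v y - m) y) has_sum s) UNIV"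
        by (subst has_sum_reindex) (auto simp: inj_on_def comp_def)
      finally have "(\<lambda>k. g (k, v y - m) y) sums s" by (rule has_sum_imp_sums)
      moreover have "(\<lambda>k. g (k, v y - m) y) sums ?h y"
        using sums_mult[OF fy, of "of_real (q powi (- m) * \<kappa> (v y - m))"] y
        by (simp add: g_def sphere_def mult_ac)
      ultimately have "s = ?h y" by (rule sums_unique2)
      then show "(\<lambda>e. g (pair_enum e) y) sums ?h y" using has_sum_imp_sums[OF s] by simp
    qed
  qed
  have h: "?h \<in> borel_measurable N"
    using measurable_of_v[of "\<lambda>j. of_real (q powi (- m) * \<kappa> (j - m))"] f_measurable
    by (intro borel_measurable_times)
  show "integrable N ?h" by (rule integral_series(1)[OF int sm lim h])
  have "(\<lambda>e. \<integral>y. g (pair_enum e) y \<partial>N) sums (\<integral>y. ?h y \<partial>N)"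
    by (rule integral_series(2)[OF int sm lim h])
  then show "(\<lambda>e. c (fst (pair_enum e)) * of_real (q powi (- m) * \<kappa> (snd (pair_enum e))) *
              (LINT y:sphere (m + snd (pair_enum e))|N. a (fst (pair_enum e)) y))
         sums (\<integral>y. ?h y \<partial>N)"
    by (simp only: g_def set_lebesgue_integral_def integral_mult_right_zero)
qed

text \<open>The factor (1 - 1/q) q^(-i \<beta>) is the inverse of the normalising factor in
  \<open>out_block\<close>, so coefficient times block is c_k \<kappa>(i) A_i a_k.\<close>

definition out_coeff :: "nat \<Rightarrow> complex" where
  "out_coeff e = (case pair_enum e of (k, i) \<Rightarrow>
     c k * of_real ((1 - 1 / q) * (\<kappa> i * q powr (- (of_int i * \<beta>)))))"

definition out_block :: "nat \<Rightarrow> 'a \<Rightarrow> complex" where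
  "out_block e = (case pair_enum e of (k, i) \<Rightarrow>
     (\<lambda>x. of_real (q powr (of_int i * \<beta>) / (1 - 1 / q)) * average i (a k) x))"

lemma out_block: "block (out_block e) (n (fst (pair_enum e)) - snd (pair_enum e))"
  unfolding out_block_def using block_average[OF a_block] by (auto split: prod.split)

lemma out_coeff_sums:
  "(\<lambda>e. cmod (out_coeff e)) sums
     ((1 - 1 / q) * (\<Sum>\<^sub>\<infinity>i. \<kappa> i * q powr (- (of_int i * \<beta>))) * (\<Sum>k. cmod (c k)))"
proof -
  have D: "0 < 1 - 1 / q" using q by simp
  have "cmod (out_coeff e) = (1 - 1 / q) * (cmod (c (fst (pair_enum e))) *
     (\<kappa> (snd (pair_enum e)) * q powr (- (of_int (snd (pair_enum e)) * \<beta>))))" for e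
    unfolding out_coeff_def using D \<kappa>_nonneg
    by (auto simp: norm_mult split: prod.split simp del: of_real_mult of_real_diff of_real_divide)
  then show ?thesis
    using sums_mult[OF sums_pair_enum_product[OF c_summable _ \<kappa>_summable], of "1 - 1 / q"] \<kappa>_nonneg
    by (simp add: mult_ac)
qed

lemma out_sums:
  "(\<lambda>e. out_coeff e * out_block e x) sums (\<integral>y. of_real (q powi (- v x) * \<kappa> (v y - v x)) * f y \<partial>N)"
proof -
  have "out_coeff e * out_block e x = c (fst (pair_enum e)) * of_real (q powi (- v x) * \<kappa> (snd (pair_enum e))) *
              (LINT y:sphere (v x + snd (pair_enum e))|N. a (fst (pair_enum e)) y)" for e
  proof -
    obtain k i where ki: "pair_enum e = (k, i)" by fastforce
    have one: "(1 - 1 / q) * (\<kappa> i * q powr (- (of_int i * \<beta>))) * (q powr (of_int i * \<beta>) / (1 - 1 / q)) = \<kappa> i"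
      using q by (simp add: powr_minus)
    have "out_coeff e * out_block e x = c k *
       of_real ((1 - 1 / q) * (\<kappa> i * q powr (- (of_int i * \<beta>))) * (q powr (of_int i * \<beta>) / (1 - 1 / q))) * average i (a k) x"
      unfolding out_coeff_def out_block_def ki by (simp only: prod.case of_real_mult mult_ac)
    then show ?thesis unfolding one by (simp add: ki average_def mult_ac)
  qed
  then show ?thesis using kernel_integral_sums(2)[of "v x"] by simp
qed

end

end

section \<open>The operator on block spaces\<close>

context haar_Qp
begin

lemma spheres_star:
  "1 < r \<Longrightarrow> 0 < \<alpha> \<Longrightarrow> spheres (star_measure p M) (plog p) (real p) r \<alpha>"
  using p_gt_1 measurable_plog emeasure_plog_sphere by unfold_locales (auto simp: space_star)

lemma central_block_iff:
  assumes "1 < r" "0 < \<alpha>"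
  shows "central_block p M r \<alpha> a \<longleftrightarrow> (\<exists>n. spheres.block (star_measure p M) (plog p) (real p) r \<alpha> a n)"
proof -
  interpret S: spheres "star_measure p M" "plog p" "real p" r \<alpha> by (rule spheres_star[OF assms])
  have "measure M (pball p n) powr (- \<alpha>) = real p powr (- \<alpha> * of_int n)" for n
    using p_gt_1 by (simp add: measure_pball powi_eq_powr powr_powr mult.commute)
  then show ?thesis
    unfolding central_block_def S.block_def space_star using pball_iff_plog[OF p] by metis
qed

text \<open>A compact subset of the punctured line has finite measure and meets finitely many
  spheres, so a radial function is bounded on it, whatever G does near 0 and at infinity.\<close>

lemma in_Lr_loc_radial:
  assumes f: "\<And>x. x \<in> Qp_star p \<Longrightarrow> f x = G (plog p x)"
  shows "in_Lr_loc p M r f"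
proof -
  have "(\<lambda>x. G (plog p x)) \<in> borel_measurable (star_measure p M)"
    by (rule measurable_compose[OF measurable_plog]) simp
  then have meas: "f \<in> borel_measurable (star_measure p M)"
    using f by (subst measurable_cong) (auto simp: space_star)
  have "set_integrable (star_measure p M) E (\<lambda>x. cmod (f x) powr r)"
    if E: "compactin (subtopology (ptop p) (Qp_star p)) E" for E
  proof -
    note sets = compactin_star(1)[OF E] and fin = compactin_star(2)[OF E]
    have sub: "E \<subseteq> Qp_star p" using sets by (simp add: sets_star)
    have "emeasure (star_measure p M) E \<le>
        emeasure (star_measure p M) (\<Union>j\<in>plog p ` E. {x \<in> Qp_star p. plog p x = j})"
      using sub by (intro emeasure_mono sets.finite_UN fin plog_sphere_sets) auto
    also have "\<dots> \<le> (\<Sum>j\<in>plog p ` E. emeasure (star_measure p M) {x \<in> Qp_star p. plog p x = j})"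
      using fin plog_sphere_sets by (intro emeasure_subadditive_finite) auto
    also have "\<dots> < \<infinity>" using fin unfolding emeasure_plog_sphere by (simp add: ennreal_sum_less_top)
    finally have "emeasure (star_measure p M) E < \<infinity>" .
    moreover have "cmod (f x) powr r \<le> (MAX j\<in>plog p ` E. cmod (G j) powr r)" if "x \<in> E" for x
    proof -
      have "f x = G (plog p x)" using that sub f by blast
      then show ?thesis using that fin by (intro Max_ge) auto
    qed
    ultimately show ?thesis
      unfolding set_integrable_def using meas sets
      by (intro integrableI_bounded_set_indicator[where B = "MAX j\<in>plog p ` E. cmod (G j) powr r"]) auto
  qed
  then show ?thesis using meas by (simp add: in_Lr_loc_def)
qed

end

lemma block_norm_le:
  assumes "block_decomp p M r \<alpha> f c a"
  shows "block_norm p M r \<alpha> f \<le> (\<Sum>k. cmod (c k))"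
  unfolding block_norm_def
  by (rule cInf_lower) (use assms in \<open>auto simp: block_decomp_def suminf_nonneg intro!: bdd_belowI[of _ 0]\<close>)

text \<open>Integrability belongs to the conclusion because the integral in
  \<open>hardy_hilbert\<close> is 0 by convention when the integrand is not integrable; with it the
  operator has its intended value at every point.\<close>

theorem theorem3p2:
  fixes p :: nat and r \<alpha> :: real and K :: "real \<Rightarrow> real \<Rightarrow> real"
    and M :: "(nat \<Rightarrow> rat) set measure" and C :: real
  assumes p: "prime p" and haar: "is_haar_Qp p M"
    and r: "1 < r" and \<alpha>: "0 < \<alpha>"
    and K_nonneg: "\<And>s t. 0 < s \<Longrightarrow> 0 < t \<Longrightarrow> 0 \<le> K s t"
    and K_homogeneous: "\<And>\<xi> s t. 0 < \<xi> \<Longrightarrow> 0 < s \<Longrightarrow> 0 < t \<Longrightarrow>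
           K (\<xi> * s) (\<xi> * t) = inverse \<xi> * K s t"
    and finite: "(\<lambda>k::int. K 1 (real p powi k) *
           real p powr (- (of_int k * (1 / r + \<alpha> - 1)))) summable_on UNIV"
    and C: "C = 2 * (1 - inverse (real p)) *
           (\<Sum>\<^sub>\<infinity>k::int. K 1 (real p powi k) * real p powr (- (of_int k * (1 / r + \<alpha> - 1))))"
  shows "\<forall>f\<in>block_space p M r \<alpha>.
           (\<forall>x\<in>Qp_star p. integrable (star_measure p M)
               (\<lambda>y. complex_of_real (K (pabs p x) (pabs p y)) * f y)) \<and>
           hardy_hilbert p M K f \<in> block_space p M r \<alpha> \<and>
           block_norm p M r \<alpha> (hardy_hilbert p M K f) \<le> C * block_norm p M r \<alpha> f"
proof -
  interpret haar_Qp p M using p haar by unfold_locales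
  interpret S: spheres "star_measure p M" "plog p" "real p" r \<alpha> by (rule spheres_star[OF r \<alpha>])
  define \<kappa> where "\<kappa> i = K 1 (real p powi i)" for i
  have \<kappa>_nonneg: "0 \<le> \<kappa> i" for i using K_nonneg p_gt_1 by (simp add: \<kappa>_def)
  have \<kappa>_summable: "(\<lambda>i. \<kappa> i * real p powr (- (of_int i * (1 / r + \<alpha> - 1)))) summable_on UNIV"
    using finite by (simp add: \<kappa>_def)
  have "0 \<le> (\<Sum>\<^sub>\<infinity>i. \<kappa> i * real p powr (- (of_int i * (1 / r + \<alpha> - 1))))"
    using \<kappa>_nonneg by (intro infsum_nonneg) auto
  moreover have C_eq: "(1 - 1 / real p) *
      (\<Sum>\<^sub>\<infinity>i. \<kappa> i * real p powr (- (of_int i * (1 / r + \<alpha> - 1)))) = C / 2"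
    by (simp add: C \<kappa>_def inverse_eq_divide)
  moreover have "0 \<le> 1 - 1 / real p" using p_gt_1 by simp
  ultimately have C_nonneg: "0 \<le> C" using mult_nonneg_nonneg by fastforce
  have kernel: "K (pabs p x) (pabs p y) = real p powi (- plog p x) * \<kappa> (plog p y - plog p x)"
    if "x \<in> Qp_star p" "y \<in> Qp_star p" for x y
  proof -
    have "real p powi plog p y = real p powi plog p x * real p powi (plog p y - plog p x)"
      using p_gt_1 by (simp flip: power_int_add)
    then show ?thesis
      using K_homogeneous[of "real p powi plog p x" 1 "real p powi (plog p y - plog p x)"] p_gt_1 that
      by (simp add: pabs_eq_plog[OF p] \<kappa>_def power_int_minus)
  qed
  have radial: "hardy_hilbert p M K f x =
      (\<integral>y. of_real (real p powi (- plog p x) * \<kappa> (plog p y - plog p x)) * f y \<partial>star_measure p M)"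
    if "x \<in> Qp_star p" for f x
    unfolding hardy_hilbert_def using that kernel
    by (intro Bochner_Integration.integral_cong) (auto simp: space_star)
  \<comment> \<open>Stated for every decomposition of f, since the norm bound is obtained by passing
    to the infimum over all of them at the end.\<close>
  have image: "(\<forall>x\<in>Qp_star p. integrable (star_measure p M)
               (\<lambda>y. complex_of_real (K (pabs p x) (pabs p y)) * f y)) \<and>
      (\<exists>c' a'. block_decomp p M r \<alpha> (hardy_hilbert p M K f) c' a' \<and>
         (\<Sum>k. cmod (c' k)) = C / 2 * (\<Sum>k. cmod (c k)))"
    if dec: "block_decomp p M r \<alpha> f c a" and f: "f \<in> borel_measurable (star_measure p M)" for f c a
  proof
    obtain n where blocks: "\<And>k. S.block (a k) (n k)"
      using dec unfolding block_decomp_def central_block_iff[OF r \<alpha>] by metis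
    have c: "summable (\<lambda>k. cmod (c k))"
      and AE: "AE x in star_measure p M. (\<lambda>k. c k * a k x) sums f x"
      using dec by (auto simp: block_decomp_def)
    note ctx = \<kappa>_nonneg \<kappa>_summable c blocks f AE
    show "\<forall>x\<in>Qp_star p. integrable (star_measure p M)
               (\<lambda>y. complex_of_real (K (pabs p x) (pabs p y)) * f y)"
    proof
      fix x assume x: "x \<in> Qp_star p"
      show "integrable (star_measure p M) (\<lambda>y. complex_of_real (K (pabs p x) (pabs p y)) * f y)"
        using S.kernel_integral_sums(1)[OF ctx, of "plog p x"] kernel[OF x]
        by (subst Bochner_Integration.integrable_cong[OF refl]) (auto simp: space_star)
    qed
    have sums: "(\<lambda>e. S.out_coeff \<kappa> c e * S.out_block a e x) sums hardy_hilbert p M K f x"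
      if "x \<in> Qp_star p" for x
      unfolding radial[OF that] by (rule S.out_sums[OF ctx])
    have "block_decomp p M r \<alpha> (hardy_hilbert p M K f) (S.out_coeff \<kappa> c) (S.out_block a)"
      unfolding block_decomp_def central_block_iff[OF r \<alpha>]
      using S.out_coeff_sums[OF ctx] S.out_block[OF ctx] sums
      by (auto simp: sums_iff space_star intro!: AE_I2)
    moreover have "(\<Sum>k. cmod (S.out_coeff \<kappa> c k)) = C / 2 * (\<Sum>k. cmod (c k))"
      using sums_unique[OF S.out_coeff_sums[OF ctx]] by (simp only: C_eq)
    ultimately show "\<exists>c' a'. block_decomp p M r \<alpha> (hardy_hilbert p M K f) c' a' \<and>
         (\<Sum>k. cmod (c' k)) = C / 2 * (\<Sum>k. cmod (c k))" by blast
  qed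
  show ?thesis
  proof (intro ballI)
    fix f assume "f \<in> block_space p M r \<alpha>"
    then obtain c a where dec: "block_decomp p M r \<alpha> f c a" and meas: "f \<in> borel_measurable (star_measure p M)"
      by (auto simp: block_space_def in_Lr_loc_def)
    have "in_Lr_loc p M r (hardy_hilbert p M K f)"
      by (rule in_Lr_loc_radial[where G = "\<lambda>m. \<integral>y. of_real (real p powi (- m) * \<kappa> (plog p y - m)) * f y \<partial>star_measure p M"])
        (rule radial)
    then have mem: "hardy_hilbert p M K f \<in> block_space p M r \<alpha>"
      using image[OF dec meas] by (auto simp: block_space_def)
    have le: "block_norm p M r \<alpha> (hardy_hilbert p M K f) \<le> C * s"
      if s: "s \<in> {(\<Sum>k. cmod (c k)) | c a. block_decomp p M r \<alpha> f c a}" for s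
    proof -
      obtain c a where ca: "block_decomp p M r \<alpha> f c a" "s = (\<Sum>k. cmod (c k))" using s by blast
      obtain c' a' where "block_decomp p M r \<alpha> (hardy_hilbert p M K f) c' a'"
        "(\<Sum>k. cmod (c' k)) = C / 2 * s" using image[OF ca(1) meas] ca(2) by blast
      then have "block_norm p M r \<alpha> (hardy_hilbert p M K f) \<le> C / 2 * s"
        using block_norm_le by metis
      moreover have "0 \<le> C * s"
        using C_nonneg ca by (auto simp: block_decomp_def suminf_nonneg)
      ultimately show ?thesis by simp
    qed
    have "block_norm p M r \<alpha> (hardy_hilbert p M K f) \<le> C * block_norm p M r \<alpha> f"
    \<comment> \<open>Passing to the infimum divides by C. If C = 0, any single decomposition
      already bounds the norm by 0.\<close>
    proof (cases "C = 0")
      case True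
      then show ?thesis using le dec by auto
    next
      case False
      then have "0 < C" using C_nonneg by simp
      then have "block_norm p M r \<alpha> (hardy_hilbert p M K f) / C \<le> block_norm p M r \<alpha> f"
        unfolding block_norm_def[of p M r \<alpha> f] using dec le
        by (intro cInf_greatest) (auto simp: pos_divide_le_eq mult.commute)
      then show ?thesis using \<open>0 < C\<close> by (simp add: pos_divide_le_eq mult.commute)
    qed
    then show "(\<forall>x\<in>Qp_star p. integrable (star_measure p M)
               (\<lambda>y. complex_of_real (K (pabs p x) (pabs p y)) * f y)) \<and>
           hardy_hilbert p M K f \<in> block_space p M r \<alpha> \<and>
           block_norm p M r \<alpha> (hardy_hilbert p M K f) \<le> C * block_norm p M r \<alpha> f"
      using image[OF dec meas] mem by blast
  qed
qed

end
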